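(* If $(Q,\ast)$ is an M-loop which is isotopic to an F-quasigroup, then $(Q,\ast)$ is a Moufang loop.
   Context: A quasigroup $(Q,\cdot)$ is a set with a binary operation such that for all $a,b\in Q$ the equations $a\cdot x=b$ and $y\cdot a=b$ have unique solutions; a loop is a quasigroup with a two-sided identity $1$. Juxtaposition binds more tightly than the dot. In a loop, $I$ is the permutation defined by $x\cdot Ix=1$. A loop is a left M-loop if there is a mapping $\varphi$ of $Q$ to itself with $x\cdot(y\cdot z)=(x\cdot(y\cdot I\varphi x))\cdot(\varphi x\cdot z)$ for all $x,y,z$; a right M-loop if there is a mapping $\psi$ of $Q$ to itself with $(y\cdot z)\cdot x=(y\cdot\psi x)\cdot((I^{-1}\psi x\cdot z)\cdot x)$ for all $x,y,z$; an M-loop if it is both a left and a right M-loop. A loop is Moufang if $x(yz\cdot x)=xy\cdot zx$ for all $x,y,z$. The maps $e,f$ of a quasigroup are defined by $x\cdot e(x)=x$ and $f(x)\cdot x=x$. An F-quasigroup is a quasigroup satisfying both $x\cdot yz=xy\cdot e(x)z$ and $xy\cdot z=xf(z)\cdot yz$ for all $x,y,z$. Two groupoids $(Q,\ast)$ and $(P,\cdot)$ are isotopic if there are bijections $\alpha,\beta,\gamma:Q\to P$ with $\gamma(x\ast y)=\alpha x\cdot\beta y$ for all $x,y\in Q$. *)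

theory Defs
  imports Main "HOL-Library.FuncSet"
begin

locale quasigroup =
  fixes Q :: "'a set"
    and mult :: "'a \<Rightarrow> 'a \<Rightarrow> 'a" (infixl "\<cdot>" 70)
  assumes closed: "\<lbrakk>a \<in> Q; b \<in> Q\<rbrakk> \<Longrightarrow> a \<cdot> b \<in> Q"
    and ex1_left: "\<lbrakk>a \<in> Q; b \<in> Q\<rbrakk> \<Longrightarrow> \<exists>!x. x \<in> Q \<and> a \<cdot> x = b"
    and ex1_right: "\<lbrakk>a \<in> Q; b \<in> Q\<rbrakk> \<Longrightarrow> \<exists>!y. y \<in> Q \<and> y \<cdot> a = b"
begin

definition e :: "'a \<Rightarrow> 'a" where
  "e x = (THE y. y \<in> Q \<and> x \<cdot> y = x)"

definition f :: "'a \<Rightarrow> 'a" where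
  "f x = (THE y. y \<in> Q \<and> y \<cdot> x = x)"

lemma e: assumes "x \<in> Q" shows "e x \<in> Q" "x \<cdot> e x = x"
  using theI'[OF ex1_left[OF assms assms]] unfolding e_def by auto

lemma f: assumes "x \<in> Q" shows "f x \<in> Q" "f x \<cdot> x = x"
  using theI'[OF ex1_right[OF assms assms]] unfolding f_def by auto

end

locale F_quasigroup = quasigroup +
  assumes F_left: "\<lbrakk>x \<in> Q; y \<in> Q; z \<in> Q\<rbrakk> \<Longrightarrow> x \<cdot> (y \<cdot> z) = (x \<cdot> y) \<cdot> (e x \<cdot> z)"
    and F_right: "\<lbrakk>x \<in> Q; y \<in> Q; z \<in> Q\<rbrakk> \<Longrightarrow> (x \<cdot> y) \<cdot> z = (x \<cdot> f z) \<cdot> (y \<cdot> z)"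

locale loop = quasigroup +
  assumes ex_identity: "\<exists>u\<in>Q. \<forall>x\<in>Q. u \<cdot> x = x \<and> x \<cdot> u = x"
begin

definition one :: "'a" ("\<one>") where
  "\<one> = (THE u. u \<in> Q \<and> (\<forall>x\<in>Q. u \<cdot> x = x \<and> x \<cdot> u = x))"

definition I :: "'a \<Rightarrow> 'a" where
  "I x = (THE y. y \<in> Q \<and> x \<cdot> y = \<one>)"

lemma one: "\<one> \<in> Q" "x \<in> Q \<Longrightarrow> \<one> \<cdot> x = x" "x \<in> Q \<Longrightarrow> x \<cdot> \<one> = x"
proof -
  have "\<exists>!u. u \<in> Q \<and> (\<forall>x\<in>Q. u \<cdot> x = x \<and> x \<cdot> u = x)"
    using ex_identity by metis
  from theI'[OF this] show "\<one> \<in> Q" "x \<in> Q \<Longrightarrow> \<one> \<cdot> x = x" "x \<in> Q \<Longrightarrow> x \<cdot> \<one> = x"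
    unfolding one_def by auto
qed

lemma I: assumes "x \<in> Q" shows "I x \<in> Q" "x \<cdot> I x = \<one>"
  using theI'[OF ex1_left[OF assms one(1)]] unfolding I_def by auto

lemma bij_betw_I: "bij_betw I Q Q"
proof (rule bij_betwI')
  fix x y assume "x \<in> Q" "y \<in> Q"
  then show "(I x = I y) = (x = y)"
    using I ex1_right one(1) by metis
next
  fix y assume y: "y \<in> Q"
  then obtain x where x: "x \<in> Q" "x \<cdot> y = \<one>" using ex1_right one(1) by metis
  then have "y = I x" using y I ex1_left one(1) by metis
  with x show "\<exists>x\<in>Q. y = I x" by blast
qed (rule I)

end

locale left_M_loop = loop +
  assumes left_M: "\<exists>\<phi> \<in> Q \<rightarrow> Q. \<forall>x\<in>Q. \<forall>y\<in>Q. \<forall>z\<in>Q.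
    x \<cdot> (y \<cdot> z) = (x \<cdot> (y \<cdot> I (\<phi> x))) \<cdot> (\<phi> x \<cdot> z)"

locale right_M_loop = loop +
  assumes right_M: "\<exists>\<psi> \<in> Q \<rightarrow> Q. \<forall>x\<in>Q. \<forall>y\<in>Q. \<forall>z\<in>Q.
    (y \<cdot> z) \<cdot> x = (y \<cdot> \<psi> x) \<cdot> ((inv_into Q I (\<psi> x) \<cdot> z) \<cdot> x)"

locale M_loop = left_M_loop + right_M_loop

locale Moufang_loop = loop +
  assumes Moufang: "\<lbrakk>x \<in> Q; y \<in> Q; z \<in> Q\<rbrakk> \<Longrightarrow> x \<cdot> ((y \<cdot> z) \<cdot> x) = (x \<cdot> y) \<cdot> (z \<cdot> x)"

definition isotopic ::
  "'a set \<Rightarrow> ('a \<Rightarrow> 'a \<Rightarrow> 'a) \<Rightarrow> 'b set \<Rightarrow> ('b \<Rightarrow> 'b \<Rightarrow> 'b) \<Rightarrow> bool" where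
  "isotopic Q m P n \<longleftrightarrow>
    (\<exists>\<alpha> \<beta> \<gamma>. bij_betw \<alpha> Q P \<and> bij_betw \<beta> Q P \<and> bij_betw \<gamma> Q P \<and>
      (\<forall>x\<in>Q. \<forall>y\<in>Q. \<gamma> (m x y) = n (\<alpha> x) (\<beta> y)))"

end

theory Submission
  imports Defs
begin

text \<open>Every F-quasigroup has a principal isotope that is a Moufang loop, and all loops isotopic to a
Moufang loop are Moufang; so a loop isotopic to an F-quasigroup is Moufang.

Permutations are written additively, as elements of a noncommutative group. Let \<open>L x\<close> and \<open>R x\<close> be
the translations of an F-quasigroup. The two F-laws say that \<open>(L x, L (e x), L x)\<close> and
\<open>(R (f x), R x, R x)\<close> are autotopisms. For the isotope \<open>x \<odot> y = (x / b) \<cdot> (b \<setminus> y)\<close>, the Moufang identity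
with outer factor \<open>c = u \<cdot> b = b \<cdot> v\<close> says that there is an autotopism with first component
\<open>- R b + (L u - L b) + R b\<close> and third component \<open>(L u - L b) + (R v - R b)\<close>. The F-laws yield an
autotopism with this third component, but with first component \<open>(L u - L b) + (R (f v) - R (f b))\<close>.
Hence it suffices that the two first components agree modulo the normal subgroup \<open>middles\<close> of all \<open>A\<close>
that occur in an autotopism \<open>(A, B, 0)\<close>; these correspond to the middle nucleus.

Let \<open>E\<close> and \<open>F\<close> be the images of the endomorphisms \<open>e\<close> and \<open>f\<close>, and \<open>K = E \<inter> F\<close>. Modulo \<open>middles\<close> the
translations by elements of \<open>K\<close> do not change when \<open>e\<close> or \<open>f\<close> is applied to the element, so they obey
the rules for the translations of a distributive quasigroup. A distributive quasigroup satisfies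
\<open>(x \<cdot> t) \<cdot> (y \<cdot> x) = (x \<cdot> y) \<cdot> (t \<cdot> x)\<close>, and the argument for this carries over to translations modulo
\<open>middles\<close> (\<open>l_r_exchange\<close>). A nontrivial element of \<open>middles\<close> moves every point, whereas both sides
agree at \<open>y = t\<close>; so the identity holds exactly for \<open>x \<in> K\<close>, \<open>t \<in> E\<close> (\<open>L_R_exchange\<close>).

For \<open>b = k \<cdot> k\<close> with \<open>k \<in> K\<close> this identity says that elements of \<open>E\<close> commute with all elements in the
loop \<open>\<odot>\<close>. Moreover every element is the product of a left nuclear element and an element of \<open>E\<close>
(\<open>lnuc_E_decomposition\<close>). So, although \<open>\<odot>\<close> is not commutative, the first two components of the autotopism
induced by \<open>L u - L b\<close>, \<open>u \<in> K\<close>, may be interchanged (\<open>swapped_autotopism\<close>). This gives one more relation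
modulo \<open>middles\<close>, and the required congruence follows by a computation in a group (\<open>quot_Moufang\<close>).\<close>

section \<open>Permutations as a group\<close>

typedef 'a bijection = "{h :: 'a \<Rightarrow> 'a. bij h}"
  morphisms apply_bij Abs_bijection
  by (rule exI[of _ id]) simp

setup_lifting type_definition_bijection

notation apply_bij (infixr "\<star>" 80)

instantiation bijection :: (type) group_add
begin

lift_definition zero_bijection :: "'a bijection" is id by simp

lift_definition plus_bijection :: "'a bijection \<Rightarrow> 'a bijection \<Rightarrow> 'a bijection" is "(\<circ>)"
  by (rule bij_comp)

lift_definition uminus_bijection :: "'a bijection \<Rightarrow> 'a bijection" is inv
  by (rule bij_imp_bij_inv)

definition minus_bijection :: "'a bijection \<Rightarrow> 'a bijection \<Rightarrow> 'a bijection"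
  where "minus_bijection g h = g + - h"

instance
proof
  fix a b c :: "'a bijection"
  show "a + b + c = a + (b + c)" by transfer (simp add: comp_assoc)
  show "0 + a = a" by transfer simp
  show "a + 0 = a" by transfer simp
  show "- a + a = 0" by transfer (simp add: bij_is_inj)
  show "a + - b = a - b" by (simp add: minus_bijection_def)
qed

end

lemma zero_apply [simp]: "0 \<star> x = x"
  by transfer simp

lemma plus_apply [simp]: "(g + h) \<star> x = g \<star> h \<star> x"
  by transfer simp

lemma apply_uminus_apply [simp]: "g \<star> (- g) \<star> x = x" "(- g) \<star> g \<star> x = x"
  by (metis plus_apply right_minus zero_apply, metis plus_apply left_minus zero_apply)

lemma minus_apply [simp]: "(g - h) \<star> x = g \<star> (- h) \<star> x"
  by (metis diff_conv_add_uminus plus_apply)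

lemma bijection_eqI: "(\<And>x. g \<star> x = h \<star> x) \<Longrightarrow> g = h"
  by transfer auto

lemma apply_eq_iff [simp]: "g \<star> x = g \<star> y \<longleftrightarrow> x = y"
  by (metis apply_uminus_apply(2))

lemma uminus_apply_eq_iff: "(- g) \<star> x = y \<longleftrightarrow> x = g \<star> y"
  by (metis apply_uminus_apply)

text \<open>The quotient \<open>G / N\<close> is represented by the permutations that \<open>G\<close> induces on the cosets of \<open>N\<close>. These
are elements of a type of class \<open>group_add\<close> again, so that computing modulo \<open>N\<close> becomes equational
reasoning in that type, without carrier sets.\<close>

locale normal_subgroup =
  fixes G N :: "'g::group_add set"
  assumes zero_G: "0 \<in> G"
    and add_G: "\<lbrakk>g \<in> G; h \<in> G\<rbrakk> \<Longrightarrow> g + h \<in> G"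
    and uminus_G: "g \<in> G \<Longrightarrow> - g \<in> G"
    and zero_N: "0 \<in> N"
    and add_N: "\<lbrakk>g \<in> N; h \<in> N\<rbrakk> \<Longrightarrow> g + h \<in> N"
    and uminus_N: "g \<in> N \<Longrightarrow> - g \<in> N"
    and conj_N: "\<lbrakk>g \<in> G; n \<in> N\<rbrakk> \<Longrightarrow> g + n - g \<in> N"
begin

lemma diff_G: "\<lbrakk>g \<in> G; h \<in> G\<rbrakk> \<Longrightarrow> g - h \<in> G"
  by (metis add_G uminus_G diff_conv_add_uminus)

definition cosets :: "'g set set" where
  "cosets = (\<lambda>h. (+) h ` N) ` G"

lemma translate_image: "(+) g ` (+) h ` X = (+) (g + h) ` (X :: 'g set)"
  by (simp add: image_image add.assoc)

lemma cosets_translate: "\<lbrakk>g \<in> G; X \<in> cosets\<rbrakk> \<Longrightarrow> (+) g ` X \<in> cosets"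
  unfolding cosets_def by (auto simp: translate_image intro!: imageI add_G)

text \<open>Sets that are not cosets stay fixed: a proper subset of a coset may be moved by \<open>N\<close>, and the action of
\<open>N\<close> must be trivial.\<close>

definition act :: "'g \<Rightarrow> 'g set \<Rightarrow> 'g set" where
  "act g X = (if X \<in> cosets then (+) g ` X else X)"

lemma act_add: "\<lbrakk>g \<in> G; h \<in> G\<rbrakk> \<Longrightarrow> act (g + h) = act g \<circ> act h"
  by (auto simp: act_def fun_eq_iff translate_image cosets_translate)

lemma act_zero: "act 0 = id"
  by (auto simp: act_def fun_eq_iff)

lemma bij_act: "g \<in> G \<Longrightarrow> bij (act g)"
  by (rule o_bij[of "act (- g)"]) (simp_all add: act_add[symmetric] uminus_G act_zero)

definition quot :: "'g \<Rightarrow> 'g set bijection" where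
  "quot g = Abs_bijection (act g)"

lemma apply_quot: "g \<in> G \<Longrightarrow> quot g \<star> X = act g X"
  unfolding quot_def by (simp add: Abs_bijection_inverse bij_act)

lemma quot_add: "\<lbrakk>g \<in> G; h \<in> G\<rbrakk> \<Longrightarrow> quot (g + h) = quot g + quot h"
  by (rule bijection_eqI) (simp add: apply_quot add_G act_add)

lemma quot_uminus: "g \<in> G \<Longrightarrow> quot (- g) = - quot g"
  by (rule minus_unique[symmetric], rule bijection_eqI)
     (simp add: apply_quot uminus_G act_add[THEN fun_cong, simplified, symmetric] act_zero)

lemma quot_diff: "\<lbrakk>g \<in> G; h \<in> G\<rbrakk> \<Longrightarrow> quot (g - h) = quot g - quot h"
  by (metis quot_add quot_uminus uminus_G diff_conv_add_uminus)

lemma quot_eq_zero_iff: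
  assumes "g \<in> G" shows "quot g = 0 \<longleftrightarrow> g \<in> N"
proof
  assume "quot g = 0"
  then have "quot g \<star> ((+) 0 ` N) = (+) 0 ` N" by simp
  moreover have "(+) 0 ` N \<in> cosets" unfolding cosets_def using zero_G by blast
  ultimately have "(+) g ` N = N" using assms by (simp add: apply_quot act_def)
  then show "g \<in> N" using zero_N by (metis add.right_neutral imageI)
next
  assume g: "g \<in> N"
  have "(+) g ` X = X" if X: "X \<in> cosets" for X
  proof -
    from X obtain h where h: "h \<in> G" "X = (+) h ` N" unfolding cosets_def by blast
    have N: "(+) n ` N = N" if "n \<in> N" for n
    proof
      show "(+) n ` N \<subseteq> N" using that add_N by auto
      have "m = n + (- n + m)" "- n + m \<in> N" if "m \<in> N" for m
        using that \<open>n \<in> N\<close> add_N uminus_N by (auto simp: add.assoc[symmetric])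
      then show "N \<subseteq> (+) n ` N" by blast
    qed
    have "- h + g - - h \<in> N" using conj_N[OF uminus_G[OF h(1)] g] .
    moreover have "g + h = h + (- h + g - - h)" by (simp add: add.assoc[symmetric])
    ultimately show ?thesis using h(2) N translate_image by metis
  qed
  then show "quot g = 0" using assms by (intro bijection_eqI) (simp add: apply_quot act_def)
qed

lemma quot_eq_iff: "\<lbrakk>g \<in> G; h \<in> G\<rbrakk> \<Longrightarrow> quot g = quot h \<longleftrightarrow> g - h \<in> N"
  using quot_eq_zero_iff[of "g - h"] by (simp add: quot_diff diff_G)

end


section \<open>Translations and autotopisms of a quasigroup\<close>

context quasigroup
begin

lemma left_cancel: "\<lbrakk>a \<in> Q; x \<in> Q; y \<in> Q\<rbrakk> \<Longrightarrow> a \<cdot> x = a \<cdot> y \<longleftrightarrow> x = y"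
  using ex1_left closed by metis

lemma right_cancel: "\<lbrakk>a \<in> Q; x \<in> Q; y \<in> Q\<rbrakk> \<Longrightarrow> x \<cdot> a = y \<cdot> a \<longleftrightarrow> x = y"
  using ex1_right closed by metis

text \<open>Translations are extended by the identity outside the carrier, so that equations between them can be
stated as equations in the group of all permutations of the type.\<close>

definition L :: "'a \<Rightarrow> 'a bijection" where
  "L x = Abs_bijection (\<lambda>y. if y \<in> Q then x \<cdot> y else y)"

definition R :: "'a \<Rightarrow> 'a bijection" where
  "R x = Abs_bijection (\<lambda>y. if y \<in> Q then y \<cdot> x else y)"

lemma L_apply': assumes "x \<in> Q" shows "L x \<star> y = (if y \<in> Q then x \<cdot> y else y)"
proof -
  have "bij (\<lambda>y. if y \<in> Q then x \<cdot> y else y)"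
  proof (rule bijI)
    show "inj (\<lambda>y. if y \<in> Q then x \<cdot> y else y)"
      by (rule injI) (metis assms closed left_cancel)
    show "surj (\<lambda>y. if y \<in> Q then x \<cdot> y else y)"
      by (rule surjI[of _ "\<lambda>y. if y \<in> Q then THE z. z \<in> Q \<and> x \<cdot> z = y else y"])
         (use theI'[OF ex1_left[OF assms]] in auto)
  qed
  then show ?thesis unfolding L_def by (simp add: Abs_bijection_inverse)
qed

lemma R_apply': assumes "x \<in> Q" shows "R x \<star> y = (if y \<in> Q then y \<cdot> x else y)"
proof -
  have "bij (\<lambda>y. if y \<in> Q then y \<cdot> x else y)"
  proof (rule bijI)
    show "inj (\<lambda>y. if y \<in> Q then y \<cdot> x else y)"
      by (rule injI) (metis assms closed right_cancel)
    show "surj (\<lambda>y. if y \<in> Q then y \<cdot> x else y)"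
      by (rule surjI[of _ "\<lambda>y. if y \<in> Q then THE z. z \<in> Q \<and> z \<cdot> x = y else y"])
         (use theI'[OF ex1_right[OF assms]] in auto)
  qed
  then show ?thesis unfolding R_def by (simp add: Abs_bijection_inverse)
qed

lemma L_apply [simp]: "\<lbrakk>x \<in> Q; y \<in> Q\<rbrakk> \<Longrightarrow> L x \<star> y = x \<cdot> y"
  by (simp add: L_apply')

lemma R_apply [simp]: "\<lbrakk>x \<in> Q; y \<in> Q\<rbrakk> \<Longrightarrow> R x \<star> y = y \<cdot> x"
  by (simp add: R_apply')

definition perms :: "'a bijection set" where
  "perms = {g. \<forall>y. y \<notin> Q \<longrightarrow> g \<star> y = y}"

lemma perms_apply_iff: "g \<in> perms \<Longrightarrow> g \<star> y \<in> Q \<longleftrightarrow> y \<in> Q"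
  unfolding perms_def using apply_eq_iff[of g "g \<star> y" y] by auto

lemma perms_apply [simp]: "\<lbrakk>g \<in> perms; y \<in> Q\<rbrakk> \<Longrightarrow> g \<star> y \<in> Q"
  by (simp add: perms_apply_iff)

lemma perms_eqI: "\<lbrakk>g \<in> perms; h \<in> perms; \<And>y. y \<in> Q \<Longrightarrow> g \<star> y = h \<star> y\<rbrakk> \<Longrightarrow> g = h"
  unfolding perms_def by (rule bijection_eqI, rename_tac y, case_tac "y \<in> Q") auto

lemma L_perms [simp]: "x \<in> Q \<Longrightarrow> L x \<in> perms"
  and R_perms [simp]: "x \<in> Q \<Longrightarrow> R x \<in> perms"
  unfolding perms_def by (simp_all add: L_apply' R_apply')

lemma zero_perms [simp]: "0 \<in> perms"
  and add_perms [simp]: "\<lbrakk>g \<in> perms; h \<in> perms\<rbrakk> \<Longrightarrow> g + h \<in> perms"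
  and uminus_perms [simp]: "g \<in> perms \<Longrightarrow> - g \<in> perms"
  unfolding perms_def by (simp_all add: uminus_apply_eq_iff)

lemma diff_perms [simp]: "\<lbrakk>g \<in> perms; h \<in> perms\<rbrakk> \<Longrightarrow> g - h \<in> perms"
  by (metis add_perms uminus_perms diff_conv_add_uminus)

abbreviation ldiv :: "'a \<Rightarrow> 'a \<Rightarrow> 'a" where
  "ldiv x y \<equiv> (- L x) \<star> y"

abbreviation rdiv :: "'a \<Rightarrow> 'a \<Rightarrow> 'a" where
  "rdiv y x \<equiv> (- R x) \<star> y"

lemma mult_ldiv [simp]: "\<lbrakk>x \<in> Q; y \<in> Q\<rbrakk> \<Longrightarrow> x \<cdot> ldiv x y = y"
  and mult_rdiv [simp]: "\<lbrakk>x \<in> Q; y \<in> Q\<rbrakk> \<Longrightarrow> rdiv y x \<cdot> x = y"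
  using L_apply[of x "ldiv x y"] R_apply[of x "rdiv y x"] by (simp_all del: L_apply R_apply)

lemma ldiv_eq_iff: "\<lbrakk>x \<in> Q; y \<in> Q; z \<in> Q\<rbrakk> \<Longrightarrow> ldiv x y = z \<longleftrightarrow> y = x \<cdot> z"
  and rdiv_eq_iff: "\<lbrakk>x \<in> Q; y \<in> Q; z \<in> Q\<rbrakk> \<Longrightarrow> rdiv y x = z \<longleftrightarrow> y = z \<cdot> x"
  by (simp_all add: uminus_apply_eq_iff)

lemma ldiv_mult [simp]: "\<lbrakk>x \<in> Q; y \<in> Q\<rbrakk> \<Longrightarrow> ldiv x (x \<cdot> y) = y"
  and rdiv_mult [simp]: "\<lbrakk>x \<in> Q; y \<in> Q\<rbrakk> \<Longrightarrow> rdiv (y \<cdot> x) x = y"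
  by (simp_all add: uminus_apply_eq_iff)

definition autotopism :: "'a bijection \<Rightarrow> 'a bijection \<Rightarrow> 'a bijection \<Rightarrow> bool" where
  "autotopism A B C \<longleftrightarrow> A \<in> perms \<and> B \<in> perms \<and> C \<in> perms \<and>
     (\<forall>x\<in>Q. \<forall>y\<in>Q. C \<star> (x \<cdot> y) = (A \<star> x) \<cdot> (B \<star> y))"

lemma autotopism_perms:
  assumes "autotopism A B C" shows "A \<in> perms" "B \<in> perms" "C \<in> perms"
  using assms unfolding autotopism_def by auto

lemma autotopismD:
  "\<lbrakk>autotopism A B C; x \<in> Q; y \<in> Q\<rbrakk> \<Longrightarrow> C \<star> (x \<cdot> y) = (A \<star> x) \<cdot> (B \<star> y)"
  unfolding autotopism_def by auto

lemma autotopism_zero: "autotopism 0 0 0"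
  unfolding autotopism_def by simp

lemma autotopism_add:
  "\<lbrakk>autotopism A B C; autotopism A' B' C'\<rbrakk> \<Longrightarrow> autotopism (A + A') (B + B') (C + C')"
  unfolding autotopism_def by simp

lemma autotopism_uminus:
  assumes "autotopism A B C" shows "autotopism (- A) (- B) (- C)"
proof -
  have "(- C) \<star> (x \<cdot> y) = ((- A) \<star> x) \<cdot> ((- B) \<star> y)" if "x \<in> Q" "y \<in> Q" for x y
    using autotopismD[OF assms, of "(- A) \<star> x" "(- B) \<star> y"] that autotopism_perms[OF assms]
    by (simp add: uminus_apply_eq_iff)
  then show ?thesis using autotopism_perms[OF assms] unfolding autotopism_def by simp
qed

lemma autotopism_diff:
  "\<lbrakk>autotopism A B C; autotopism A' B' C'\<rbrakk> \<Longrightarrow> autotopism (A - A') (B - B') (C - C')"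
  by (metis autotopism_add autotopism_uminus diff_conv_add_uminus)

text \<open>The first components of autotopisms, and those of autotopisms with trivial third component. In a
loop the latter are the right translations by elements of the middle nucleus.\<close>

definition firsts :: "'a bijection set" where
  "firsts = {A. \<exists>B C. autotopism A B C}"

definition middles :: "'a bijection set" where
  "middles = {A. \<exists>B. autotopism A B 0}"

sublocale mid: normal_subgroup firsts middles
proof
  show "0 \<in> firsts" "0 \<in> middles" unfolding firsts_def middles_def using autotopism_zero by auto
  show "g + h \<in> firsts" if "g \<in> firsts" "h \<in> firsts" for g h
    using that unfolding firsts_def by (auto intro: autotopism_add)
  show "- g \<in> firsts" if "g \<in> firsts" for g
    using that unfolding firsts_def by (auto intro: autotopism_uminus)
  show "g + h \<in> middles" if "g \<in> middles" "h \<in> middles" for g h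
    using that autotopism_add[of g _ 0 h _ 0] unfolding middles_def by auto
  show "- g \<in> middles" if "g \<in> middles" for g
    using that autotopism_uminus[of g _ 0] unfolding middles_def by auto
  show "g + n - g \<in> middles" if g: "g \<in> firsts" and n: "n \<in> middles" for g n
  proof -
    obtain h k where "autotopism g h k" using g unfolding firsts_def by auto
    moreover obtain m where "autotopism n m 0" using n unfolding middles_def by auto
    ultimately have "autotopism (g + n - g) (h + m - h) (k + 0 - k)"
      by (intro autotopism_diff autotopism_add)
    then show ?thesis unfolding middles_def by auto
  qed
qed

lemma firstsI: "autotopism A B C \<Longrightarrow> A \<in> firsts"
  unfolding firsts_def by auto

text \<open>Modulo \<open>middles\<close>, the first component of an autotopism is determined by the third one. This is how
relations between translations are found below: two ways to compose the autotopisms of the F-laws have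
the same third component, but visibly different first components.\<close>

lemma quot_eqI:
  assumes "autotopism A B C" "autotopism A' B' C" shows "mid.quot A = mid.quot A'"
  using autotopism_diff[OF assms] firstsI[OF assms(1)] firstsI[OF assms(2)]
  by (subst mid.quot_eq_iff) (auto simp: middles_def)

lemma autotopism_quot_eq:
  assumes "autotopism A B C" "A' \<in> firsts" "mid.quot A = mid.quot A'"
  obtains B' where "autotopism A' B' C"
proof -
  have "A' - A \<in> middles" using assms firstsI mid.quot_eq_iff by metis
  then obtain D where "autotopism (A' - A) D 0" unfolding middles_def by auto
  from autotopism_add[OF this assms(1)] show ?thesis using that by simp
qed

text \<open>A congruence modulo \<open>middles\<close> is therefore an equation as soon as both sides agree at one point.\<close>

lemma middles_fixpoint:
  assumes "A \<in> middles" "y \<in> Q" "A \<star> y = y" shows "A = 0"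
proof -
  obtain B where B: "autotopism A B 0" using assms(1) unfolding middles_def by auto
  have "B \<star> z = z" if z: "z \<in> Q" for z
    using autotopismD[OF B assms(2) z] assms autotopism_perms[OF B] z by (simp add: left_cancel)
  then have "A \<star> x = x" if x: "x \<in> Q" for x
    using autotopismD[OF B x assms(2)] assms autotopism_perms[OF B] x by (simp add: right_cancel)
  then show ?thesis by (intro perms_eqI) (use autotopism_perms[OF B] in auto)
qed

end

section \<open>F-quasigroups: exact relations between translations\<close>

text \<open>A complete rewrite system for the word problem in free groups.\<close>

lemmas group_word = diff_conv_add_uminus add.assoc minus_add minus_minus minus_zero
  add_minus_cancel minus_add_cancel left_minus right_minus add_0_left add_0_right

lemma minus_right_cancel [simp]: "a - c = b - c \<longleftrightarrow> a = b" for a b c :: "'g::group_add"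
  by (metis diff_add_cancel)

context F_quasigroup
begin

lemma e_eqI: "\<lbrakk>x \<in> Q; y \<in> Q; x \<cdot> y = x\<rbrakk> \<Longrightarrow> e x = y"
  using e left_cancel by metis

lemma f_eqI: "\<lbrakk>x \<in> Q; y \<in> Q; y \<cdot> x = x\<rbrakk> \<Longrightarrow> f x = y"
  using f right_cancel by metis

lemma e_mult: "\<lbrakk>x \<in> Q; y \<in> Q\<rbrakk> \<Longrightarrow> e (x \<cdot> y) = e x \<cdot> e y"
  by (rule e_eqI) (simp_all add: e closed F_left[symmetric])

lemma f_mult: "\<lbrakk>x \<in> Q; y \<in> Q\<rbrakk> \<Longrightarrow> f (x \<cdot> y) = f x \<cdot> f y"
  by (rule f_eqI) (simp_all add: f closed F_right[symmetric])

lemma e_f: "x \<in> Q \<Longrightarrow> e (f x) = f (e x)"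
  by (rule f_eqI[symmetric]) (simp_all add: e f e_mult[symmetric])

lemma e_ldiv: "\<lbrakk>x \<in> Q; y \<in> Q\<rbrakk> \<Longrightarrow> e (ldiv x y) = ldiv (e x) (e y)"
  by (rule sym) (simp add: ldiv_eq_iff e e_mult[symmetric] mult_ldiv)

lemma f_ldiv: "\<lbrakk>x \<in> Q; y \<in> Q\<rbrakk> \<Longrightarrow> f (ldiv x y) = ldiv (f x) (f y)"
  by (rule sym) (simp add: ldiv_eq_iff f f_mult[symmetric] mult_ldiv)

lemma e_rdiv: "\<lbrakk>x \<in> Q; y \<in> Q\<rbrakk> \<Longrightarrow> e (rdiv x y) = rdiv (e x) (e y)"
  by (rule sym) (simp add: rdiv_eq_iff e e_mult[symmetric] mult_rdiv)

lemma f_rdiv: "\<lbrakk>x \<in> Q; y \<in> Q\<rbrakk> \<Longrightarrow> f (rdiv x y) = rdiv (f x) (f y)"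
  by (rule sym) (simp add: rdiv_eq_iff f f_mult[symmetric] mult_rdiv)

definition E :: "'a set" where "E = e ` Q"
definition F :: "'a set" where "F = f ` Q"
definition K :: "'a set" where "K = E \<inter> F"

lemma E_Q: "x \<in> E \<Longrightarrow> x \<in> Q" and F_Q: "x \<in> F \<Longrightarrow> x \<in> Q"
  and K_E: "x \<in> K \<Longrightarrow> x \<in> E" and K_F: "x \<in> K \<Longrightarrow> x \<in> F" and K_Q: "x \<in> K \<Longrightarrow> x \<in> Q"
  and e_E: "x \<in> Q \<Longrightarrow> e x \<in> E" and f_F: "x \<in> Q \<Longrightarrow> f x \<in> F"
  unfolding E_def F_def K_def using e f by auto

lemma E_closed:
  assumes "x \<in> E" "y \<in> E" shows "x \<cdot> y \<in> E" "ldiv x y \<in> E" "rdiv x y \<in> E"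
  using assms unfolding E_def
  by (auto simp: e_mult[symmetric] e_ldiv[symmetric] e_rdiv[symmetric] closed)

lemma F_closed:
  assumes "x \<in> F" "y \<in> F" shows "x \<cdot> y \<in> F" "ldiv x y \<in> F" "rdiv x y \<in> F"
  using assms unfolding F_def
  by (auto simp: f_mult[symmetric] f_ldiv[symmetric] f_rdiv[symmetric] closed)

lemma K_closed:
  assumes "x \<in> K" "y \<in> K" shows "x \<cdot> y \<in> K" "ldiv x y \<in> K" "rdiv x y \<in> K"
  using assms E_closed F_closed unfolding K_def by auto

lemma f_E: assumes "x \<in> E" shows "f x \<in> K"
proof -
  obtain z where "z \<in> Q" "x = e z" using assms unfolding E_def by auto
  then have "f x = e (f z)" "f z \<in> Q" by (simp_all add: e_f f)
  then show ?thesis using f_F[OF E_Q[OF assms]] e_E unfolding K_def by (metis IntI)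
qed

lemma e_F: assumes "x \<in> F" shows "e x \<in> K"
proof -
  obtain z where "z \<in> Q" "x = f z" using assms unfolding F_def by auto
  then have "e x = f (e z)" "e z \<in> Q" by (simp_all add: e_f e)
  then show ?thesis using e_E[OF F_Q[OF assms]] f_F unfolding K_def by (metis IntI)
qed

lemma e_K: "x \<in> K \<Longrightarrow> e x \<in> K" and f_K: "x \<in> K \<Longrightarrow> f x \<in> K"
  using e_F f_E K_E K_F by auto

lemmas in_Q [simp] = closed e(1) f(1)

lemma L_L: "\<lbrakk>x \<in> Q; y \<in> Q\<rbrakk> \<Longrightarrow> L x + L y = L (x \<cdot> y) + L (e x)"
  by (rule perms_eqI) (simp_all add: F_left[symmetric])

lemma R_R: "\<lbrakk>y \<in> Q; z \<in> Q\<rbrakk> \<Longrightarrow> R z + R y = R (y \<cdot> z) + R (f z)"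
  by (rule perms_eqI) (simp_all add: F_right[symmetric])

lemma R_L: "\<lbrakk>x \<in> Q; z \<in> Q\<rbrakk> \<Longrightarrow> R z + L x = L (x \<cdot> f z) + R z"
  by (rule perms_eqI) (simp_all add: F_right[symmetric])

lemma L_R: "\<lbrakk>x \<in> Q; z \<in> Q\<rbrakk> \<Longrightarrow> L x + R z = R (e x \<cdot> z) + L x"
  by (rule perms_eqI) (simp_all add: F_left[symmetric])

lemma L_mult: "\<lbrakk>x \<in> Q; y \<in> Q\<rbrakk> \<Longrightarrow> L (x \<cdot> y) = L x + L y - L (e x)"
  by (simp add: eq_diff_eq L_L[symmetric])

lemma R_mult: "\<lbrakk>y \<in> Q; z \<in> Q\<rbrakk> \<Longrightarrow> R (y \<cdot> z) = R z + R y - R (f z)"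
  by (simp add: eq_diff_eq R_R[symmetric])

lemma L_mult_f: "\<lbrakk>x \<in> Q; z \<in> Q\<rbrakk> \<Longrightarrow> L (x \<cdot> f z) = R z + L x - R z"
  by (simp add: eq_diff_eq R_L[symmetric])

lemma R_e_mult: "\<lbrakk>x \<in> Q; z \<in> Q\<rbrakk> \<Longrightarrow> R (e x \<cdot> z) = L x + R z - L x"
  by (simp add: eq_diff_eq L_R[symmetric])

lemma R_ldiv_e:
  assumes "x \<in> Q" "z \<in> Q" shows "R (ldiv (e x) z) = - L x + R z + L x"
proof -
  have "L x + R (ldiv (e x) z) = R z + L x"
    using L_R[of x "ldiv (e x) z"] assms by (simp add: mult_ldiv)
  then have "- L x + (L x + R (ldiv (e x) z)) = - L x + (R z + L x)" by simp
  then show ?thesis by (simp only: group_word)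
qed

lemma L_rdiv_f:
  assumes "x \<in> Q" "z \<in> Q" shows "L (rdiv x (f z)) = - R z + L x + R z"
proof -
  have "R z + L (rdiv x (f z)) = L x + R z"
    using R_L[of "rdiv x (f z)" z] assms by (simp add: mult_rdiv)
  then have "- R z + (R z + L (rdiv x (f z))) = - R z + (L x + R z)" by simp
  then show ?thesis by (simp only: group_word)
qed

text \<open>Comparing the two expressions for a conjugate of a translation, which come from one F-law each,
turns a difference of left translations into a difference of right ones.\<close>

lemma L_minus_L_eq_R_minus_R:
  assumes "t \<in> E" "z \<in> Q" shows "L (f z) - L t = R (ldiv t z) - R z"
proof -
  obtain x where x: "x \<in> Q" "t = e x" using assms unfolding E_def by auto
  have "L x + L (f z) - L (e x) = R z + L x - R z"
    using x assms L_mult[of x "f z"] L_mult_f[of x z] by simp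
  then have "- L x + (L x + L (f z) - L (e x)) = - L x + (R z + L x - R z)" by simp
  then show ?thesis using x assms by (simp only: R_ldiv_e) (simp only: group_word)
qed

lemma R_minus_R_eq_L_minus_L:
  assumes "s \<in> F" "x \<in> Q" shows "R (e x) - R s = L (rdiv x s) - L x"
proof -
  obtain z where z: "z \<in> Q" "s = f z" using assms unfolding F_def by auto
  have "R z + R (e x) - R (f z) = L x + R z - L x"
    using z assms R_mult[of "e x" z] R_e_mult[of x z] by simp
  then have "- R z + (R z + R (e x) - R (f z)) = - R z + (L x + R z - L x)" by simp
  then show ?thesis using z assms by (simp only: L_rdiv_f) (simp only: group_word)
qed

text \<open>In a distributive quasigroup the next two lemmas read \<open>R t - R s = L (t / s) - L t\<close> and
\<open>L s - L t = R (t \<setminus> s) - R s\<close>: the elements \<open>t\<close> and \<open>s\<close> commute with every element of the loop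
\<open>(x / s) \<cdot> (t \<setminus> y)\<close>. The occurrences of \<open>f\<close> and \<open>e\<close> are the corrections for the general case.\<close>

lemma R_E_minus_R_F:
  assumes "t \<in> E" "s \<in> F" shows "R t - R s = L (rdiv t s) - L (f t)"
proof -
  obtain w where w: "w \<in> Q" "s = f w" using assms unfolding F_def by auto
  have t: "t \<in> Q" using assms E_Q by simp
  have "L (f t \<cdot> f w) - L t = R w - (R w + R t - R (f w))"
    using L_minus_L_eq_R_minus_R[of t "t \<cdot> w"] assms t w
    by (simp add: f_mult R_mult ldiv_eq_iff[THEN iffD2])
  also have "L (f t \<cdot> f w) = R w + L (f t) - R w" using t w by (simp add: L_mult_f)
  finally have "- R w + (R w + L (f t) - R w - L t) + R w = - R w + (R w - (R w + R t - R (f w))) + R w"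
    by simp
  then have "- (L (f t) - R w - L t + R w) = - (R (f w) - R t)"
    by (simp only: group_word)
  then have "R t - R (f w) = - R w + L t + R w - L (f t)"
    by (simp only: group_word)
  then show ?thesis using t w by (simp add: L_rdiv_f)
qed

lemma L_F_minus_L_E:
  assumes "s \<in> F" "t \<in> E" shows "L s - L t = R (ldiv t s) - R (e s)"
proof -
  obtain w where w: "w \<in> Q" "t = e w" using assms unfolding E_def by auto
  have s: "s \<in> Q" using assms F_Q by simp
  have "R (e w \<cdot> e s) - R s = L w - (L w + L s - L (e w))"
    using R_minus_R_eq_L_minus_L[of s "w \<cdot> s"] assms s w
    by (simp add: e_mult L_mult rdiv_eq_iff[THEN iffD2])
  also have "R (e w \<cdot> e s) = L w + R (e s) - L w" using s w by (simp add: R_e_mult)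
  finally have "- L w + (L w + R (e s) - L w - R s) + L w = - L w + (L w - (L w + L s - L (e w))) + L w"
    by simp
  then have "- (R (e s) - L w - R s + L w) = - (L (e w) - L s)"
    by (simp only: group_word)
  then have "L s - L (e w) = - L w + R s + L w - R (e s)"
    by (simp only: group_word)
  then show ?thesis using s w by (simp add: R_ldiv_e)
qed

text \<open>The counterpart of \<open>(x \<cdot> (x \<cdot> y)) \<cdot> (y \<cdot> z) = (x \<cdot> y) \<cdot> ((x \<cdot> y) \<cdot> z)\<close> in a distributive quasigroup. It is not a
composition of the conjugation rules for translations: the proof applies the right F-law to a product
whose right factor \<open>y \<cdot> z\<close> varies with the argument \<open>z\<close>.\<close>

lemma L_L_collapse:
  assumes "x \<in> Q" "y \<in> Q"
  shows "L (x \<cdot> e (x \<cdot> f y)) + L y = L (x \<cdot> f y) + L (e x \<cdot> y)"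
proof (rule perms_eqI)
  fix z assume z: "z \<in> Q"
  have "(x \<cdot> e (x \<cdot> f y)) \<cdot> (y \<cdot> z) = (x \<cdot> f (y \<cdot> z)) \<cdot> (e (x \<cdot> f y) \<cdot> (y \<cdot> z))"
    using assms z by (intro F_right) simp_all
  also have "x \<cdot> f (y \<cdot> z) = (x \<cdot> f y) \<cdot> (e x \<cdot> f z)"
    using assms z by (simp add: f_mult F_left[symmetric])
  also have "((x \<cdot> f y) \<cdot> (e x \<cdot> f z)) \<cdot> (e (x \<cdot> f y) \<cdot> (y \<cdot> z)) = (x \<cdot> f y) \<cdot> ((e x \<cdot> f z) \<cdot> (y \<cdot> z))"
    using assms z by (intro F_left[symmetric]) simp_all
  also have "(e x \<cdot> f z) \<cdot> (y \<cdot> z) = (e x \<cdot> y) \<cdot> z"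
    using assms z by (intro F_right[symmetric]) simp_all
  finally show "(L (x \<cdot> e (x \<cdot> f y)) + L y) \<star> z = (L (x \<cdot> f y) + L (e x \<cdot> y)) \<star> z"
    using assms z by simp
qed (use assms in simp_all)

lemma autotopism_L: "x \<in> Q \<Longrightarrow> autotopism (L x) (L (e x)) (L x)"
  unfolding autotopism_def by (simp add: F_left[symmetric])

lemma autotopism_R: "x \<in> Q \<Longrightarrow> autotopism (R (f x)) (R x) (R x)"
  unfolding autotopism_def by (simp add: F_right[symmetric])

end

section \<open>Translations modulo the middle nucleus\<close>
context F_quasigroup
begin

abbreviation l :: "'a \<Rightarrow> 'a bijection set bijection" where "l x \<equiv> mid.quot (L x)"
abbreviation r :: "'a \<Rightarrow> 'a bijection set bijection" where "r x \<equiv> mid.quot (R x)"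

lemma L_firsts [simp]: "x \<in> Q \<Longrightarrow> L x \<in> firsts"
  using autotopism_L firstsI by blast

lemma R_F_firsts: "s \<in> F \<Longrightarrow> R s \<in> firsts"
  unfolding F_def using autotopism_R firstsI by blast

lemma l_mult: "\<lbrakk>x \<in> Q; y \<in> Q\<rbrakk> \<Longrightarrow> l (x \<cdot> y) = l x + l y - l (e x)"
  by (simp add: L_mult mid.quot_add mid.quot_diff mid.add_G)

lemma r_mult:
  "\<lbrakk>y \<in> Q; z \<in> Q; R y \<in> firsts; R z \<in> firsts; R (f z) \<in> firsts\<rbrakk>
    \<Longrightarrow> r (y \<cdot> z) = r z + r y - r (f z)"
  by (simp add: R_mult mid.quot_add mid.quot_diff mid.add_G)

lemma l_mult_f: "\<lbrakk>x \<in> Q; z \<in> Q; R z \<in> firsts\<rbrakk> \<Longrightarrow> l (x \<cdot> f z) = r z + l x - r z"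
  by (simp add: L_mult_f mid.quot_add mid.quot_diff mid.add_G)

lemma r_e_mult: "\<lbrakk>x \<in> Q; z \<in> Q; R z \<in> firsts\<rbrakk> \<Longrightarrow> r (e x \<cdot> z) = l x + r z - l x"
  by (simp add: R_e_mult mid.quot_add mid.quot_diff mid.add_G)

text \<open>Both sides of \<open>R z + L z = L (z \<cdot> f z) + R z\<close> are third components. In the first components \<open>R z\<close>
becomes \<open>R (f z)\<close> while the left translations stay, and the analogous equation for \<open>f z\<close> in place of \<open>z\<close>
then compares \<open>L (z \<cdot> f z)\<close> with \<open>L (z \<cdot> f (f z))\<close>.\<close>

lemma l_f:
  assumes "s \<in> F" shows "l (f s) = l s"
proof -
  obtain z where z: "z \<in> Q" "s = f z" using assms unfolding F_def by auto
  have "mid.quot (R s + L z) = mid.quot (L (z \<cdot> s) + R s)"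
  proof (rule quot_eqI)
    show "autotopism (R s + L z) (R z + L (e z)) (R z + L z)"
      using z by (simp add: autotopism_add autotopism_L autotopism_R)
    show "autotopism (L (z \<cdot> s) + R s) (L (e (z \<cdot> s)) + R z) (R z + L z)"
      unfolding R_L[OF z(1) z(1)] z(2) using z by (intro autotopism_add autotopism_L autotopism_R) simp_all
  qed
  moreover have "R s + L z = L (z \<cdot> f s) + R s" using z by (simp add: R_L)
  ultimately have "l (z \<cdot> s) = l (z \<cdot> f s)"
    using z R_F_firsts[OF assms] by (simp add: mid.quot_add)
  then show ?thesis using z by (simp add: l_mult)
qed

text \<open>The same idea for \<open>L x + R x = R (e x \<cdot> x) + L x\<close>. The conclusion that \<open>R t\<close> is a first component is
needed before its class modulo \<open>middles\<close> makes sense: a priori this is so only for \<open>t \<in> F\<close>.\<close>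

lemma R_E:
  assumes "t \<in> E" shows "R t \<in> firsts" "r (f t) = r t"
proof -
  obtain x where x: "x \<in> Q" "t = e x" using assms unfolding E_def by auto
  have eq: "L x + R (f x) = R (t \<cdot> f x) + L x" using x by (simp add: L_R)
  have Fx: "R (f x) \<in> firsts" "R (f (f x)) \<in> firsts" "R (f t \<cdot> f x) \<in> firsts" "R (f t) \<in> firsts"
    using x by (auto intro!: R_F_firsts simp: f_F F_closed)
  have "R (t \<cdot> f x) = L x + R (f x) - L x" unfolding eq by simp
  then have tf: "R (t \<cdot> f x) \<in> firsts" using x Fx by (simp add: mid.diff_G mid.add_G)
  have "R (t \<cdot> f x) = R (f x) + R t - R (f (f x))" using x by (simp add: R_mult)
  then have "R t = - R (f x) + R (t \<cdot> f x) + R (f (f x))" by (simp only: group_word)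
  then show t: "R t \<in> firsts" using tf Fx by (simp add: mid.add_G mid.uminus_G)
  have "mid.quot (L x + R (f x)) = mid.quot (R (f t \<cdot> f x) + L x)"
  proof (rule quot_eqI)
    show "autotopism (L x + R (f x)) (L (e x) + R x) (L x + R x)"
      using x by (intro autotopism_add autotopism_L autotopism_R)
    have "autotopism (R (f (t \<cdot> x)) + L x) (R (t \<cdot> x) + L (e x)) (R (t \<cdot> x) + L x)"
      using x by (intro autotopism_add autotopism_L autotopism_R) simp_all
    then show "autotopism (R (f t \<cdot> f x) + L x) (R (t \<cdot> x) + L (e x)) (L x + R x)"
      using x by (simp add: L_R f_mult)
  qed
  then have "r (t \<cdot> f x) = r (f t \<cdot> f x)"
    unfolding eq using x tf Fx by (simp add: mid.quot_add)
  then show "r (f t) = r t" using x Fx t by (simp add: r_mult f)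
qed

lemma R_K: "k \<in> K \<Longrightarrow> R k \<in> firsts"
  using R_F_firsts K_F by simp

text \<open>By \<open>L_F_minus_L_E\<close>, \<open>l (s \<cdot> s) = r s + l s - r (e s)\<close>, whereas the right F-law gives
\<open>l (s \<cdot> f s) = r s + l s - r s\<close>; by \<open>l_f\<close> the left-hand sides agree.\<close>

lemma r_e:
  assumes "s \<in> F" shows "r (e s) = r s"
proof -
  have s: "s \<in> Q" "R s \<in> firsts" "R (e s) \<in> firsts" using assms F_Q R_F_firsts R_E e_E by auto
  have "L s - L (e s) = - L s + R s + L s - R (e s)"
    using L_F_minus_L_E[OF assms, of "e s"] s e_E by (simp add: R_ldiv_e)
  then have "l s - l (e s) = - l s + r s + l s - r (e s)"
    using s by (metis L_firsts in_Q(2) mid.quot_diff mid.quot_add mid.quot_uminus mid.add_G mid.uminus_G)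
  then have *: "l s + (l s - l (e s)) + r (e s) = l s + (- l s + r s + l s - r (e s)) + r (e s)" by simp
  have "l (s \<cdot> s) = l (s \<cdot> f s)" using s l_f[OF assms] by (simp add: l_mult)
  then have "l s + l s - l (e s) = r s + l s - r s"
    using s l_mult[of s s] l_mult_f[of s s] by simp
  then have "r s + l s - r s + r (e s) = r s + l s"
    using * by (simp only: group_word)
  then show ?thesis by (metis add_left_cancel diff_add_cancel)
qed

lemma r_f: assumes "s \<in> F" shows "r (f s) = r s"
proof -
  have "r (f s) = r (e (f s))" using assms F_Q f_F r_e by metis
  also have "\<dots> = r (e s)" using assms F_Q e_E R_E e_f by metis
  finally show ?thesis using assms r_e by simp
qed

text \<open>By \<open>R_E_minus_R_F\<close> the difference \<open>l (t / s) - l (f t)\<close> depends on \<open>r t\<close> and \<open>r s\<close> only, and those do not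
change under \<open>f\<close>.\<close>

lemma l_E:
  assumes "t \<in> E" shows "l (f t) = l t"
proof -
  define k where "k = f (f t)"
  have k: "k \<in> K" and t: "t \<in> Q" "f t \<in> K" using assms f_E f_K E_Q unfolding k_def by auto
  have "l (rdiv t' s) - l (f t') = r t' - r s" if "t' \<in> E" "s \<in> K" for t' s
    using R_E_minus_R_F[of t' s] that E_Q K_F K_Q R_E R_K
    by (metis L_firsts f(1) mid.quot_diff perms_apply uminus_perms R_perms)
  note * = this
  define t' where "t' = t \<cdot> k"
  have t': "t' \<in> E" "rdiv t' k = t" "f t' \<in> K" using assms k t E_closed K_E K_Q f_E
    unfolding t'_def by (auto simp: rdiv_eq_iff)
  have "l t - l (f t') = r t' - r k" using *[OF t'(1) k] t' by simp
  also have "\<dots> = r (f t') - r (f k)" using R_E[OF t'(1)] r_f k K_F by simp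
  also have "\<dots> = l (rdiv (f t') (f k)) - l (f (f t'))" using *[of "f t'" "f k"] t' k K_E f_K by simp
  also have "rdiv (f t') (f k) = f t" using t' k E_Q K_Q by (metis f_rdiv)
  also have "l (f (f t')) = l (f t')" using l_f t' K_F by simp
  finally show ?thesis by simp
qed

text \<open>In a distributive quasigroup the corresponding fact is \<open>k \<cdot> (x \<cdot> k) = (k \<cdot> x) \<cdot> k\<close>.\<close>

lemma l_r_commute:
  assumes "k \<in> K" shows "l k + r k = r k + l k"
proof -
  have k: "k \<in> Q" "e k \<in> K" "f k \<in> K" using assms K_Q e_K f_K by auto
  have "r (ldiv (e (f k)) (e k)) - r (e (e k)) = l (e k) - l (f (e k))"
    using L_F_minus_L_E[of "e k" "f (e k)"] k K_E K_F K_Q f_K K_closed R_K e_K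
    by (simp add: e_f flip: mid.quot_diff)
  also have "\<dots> = 0" using l_f k K_F by simp
  finally have "r (ldiv (e (f k)) (e k)) = r (e k)" using r_e k K_F by simp
  moreover have "r (ldiv (e (f k)) (e k)) = - l (f k) + r (e k) + l (f k)"
    using k K_Q R_K by (simp add: R_ldiv_e mid.quot_add mid.quot_uminus mid.add_G mid.uminus_G)
  ultimately have "- l k + r k + l k = r k" using r_e l_f assms K_F by simp
  then have "l k + (- l k + r k + l k) = l k + r k" by simp
  then show ?thesis by (simp only: group_word)
qed

lemma l_e:
  assumes "k \<in> K" shows "l (e k) = l k"
proof -
  have k: "k \<in> Q" "e k \<in> K" using assms K_Q e_K by auto
  have "l k - l (e k) = - l k + r k + l k - r (e k)"
    using arg_cong[OF L_F_minus_L_E[of k "e k"], of mid.quot] k assms K_E K_F R_K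
    by (simp add: R_ldiv_e mid.quot_add mid.quot_diff mid.quot_uminus mid.add_G mid.uminus_G)
  also have "- l k + r k + l k = r k"
    by (simp add: add.assoc l_r_commute[OF assms, symmetric])
  also have "r k - r (e k) = 0" using r_e assms K_F by simp
  finally show ?thesis by simp
qed

end

section \<open>The exchange law\<close>
lemma conj_conj_commute:
  fixes a b c :: "'g::group_add"
  assumes "a + b = b + a" shows "b + (a + c - a) - b = a + (b + c - b) - a"
proof -
  have "b + (a + c - a) - b = (b + a) + c - (b + a)" by (simp only: group_word)
  also have "\<dots> = (a + b) + c - (a + b)" by (simp only: assms)
  also have "\<dots> = a + (b + c - b) - a" by (simp only: group_word)
  finally show ?thesis .
qed

context F_quasigroup
begin

lemma l_K_mult: "\<lbrakk>x \<in> K; y \<in> K\<rbrakk> \<Longrightarrow> l (x \<cdot> y) = l x + l y - l x"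
  by (simp add: l_mult K_Q l_e)

lemma r_K_mult: "\<lbrakk>y \<in> K; z \<in> K\<rbrakk> \<Longrightarrow> r (y \<cdot> z) = r z + r y - r z"
  by (simp add: r_mult K_Q R_K f_K r_f K_F)

lemma l_K_mult': "\<lbrakk>x \<in> K; y \<in> K\<rbrakk> \<Longrightarrow> l (x \<cdot> y) = r y + l x - r y"
  using l_mult_f[of x y] l_K_mult[of x "f y"] l_K_mult[of x y] by (simp add: K_Q R_K f_K l_f K_F)

lemma r_K_mult': "\<lbrakk>x \<in> K; y \<in> K\<rbrakk> \<Longrightarrow> r (x \<cdot> y) = l x + r y - l x"
  using r_e_mult[of x y] r_K_mult[of "e x" y] r_K_mult[of x y] by (simp add: K_Q R_K e_K r_e K_F)

lemma l_K_collapse: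
  assumes "x \<in> K" "y \<in> K"
  shows "l x + l (x \<cdot> y) - l x + l y = l (x \<cdot> y) + l (x \<cdot> y)"
proof -
  have K: "x \<cdot> f y \<in> K" "e (x \<cdot> f y) \<in> K" "e x \<cdot> y \<in> K" using assms by (simp_all add: K_closed e_K f_K)
  have "l (x \<cdot> e (x \<cdot> f y)) + l y = l (x \<cdot> f y) + l (e x \<cdot> y)"
    using arg_cong[OF L_L_collapse[of x y], of mid.quot] assms by (simp add: mid.quot_add K_Q)
  moreover have "l (x \<cdot> f y) = l (x \<cdot> y)" "l (e x \<cdot> y) = l (x \<cdot> y)"
    using assms by (simp_all add: l_K_mult f_K e_K l_f l_e K_F)
  ultimately show ?thesis using assms K by (simp add: l_K_mult[of x "e (x \<cdot> f y)"] l_e)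
qed

text \<open>With \<open>w = (x \<cdot> t) \<cdot> x\<close> both sides equal \<open>l w + r (t \<cdot> x)\<close>. For the left-hand side the collapsing relation
is essential: it turns the conjugate \<open>l p + l w - l p\<close> with \<open>p = x \<cdot> t\<close> into \<open>l w + l w - l x\<close>.\<close>

lemma l_r_exchange:
  assumes x: "x \<in> K" and t: "t \<in> K"
  shows "l (x \<cdot> t) + r x = r (t \<cdot> x) + l x"
proof -
  define p where "p = x \<cdot> t"
  define w where "w = p \<cdot> x"
  have K: "p \<in> K" "w \<in> K" "t \<cdot> x \<in> K" "x \<cdot> (t \<cdot> x) \<in> K"
    unfolding w_def p_def using x t by (simp_all add: K_closed)
  have comm: "l x + r x = r x + l x" using x by (rule l_r_commute)
  have "l p + r x = r w + l p"
    unfolding w_def r_K_mult'[OF K(1) x] by simp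
  also have "r w + l p = l p + l w - l p + r w"
    using l_K_mult'[OF K(1,2)] l_K_mult[OF K(1,2)] by (metis diff_add_cancel)
  also have "l p + l w - l p = l w + l w - l x"
    using l_K_collapse[OF K(1) x] unfolding w_def[symmetric] by (metis add_diff_cancel)
  also have "l w + l w - l x + r w = l w + (- l x + r w + l x)"
  proof -
    have "l x + l w - l x = r w + l x - r w"
      using l_K_mult[OF x K(2)] l_K_mult'[OF x K(2)] by simp
    then have "- l x + (l x + l w - l x) + r w = - l x + (r w + l x - r w) + r w" by simp
    then have "l w - l x + r w = - l x + r w + l x" by (simp only: group_word)
    then show ?thesis by (simp only: group_word)
  qed
  also have "- l x + r w + l x = r (t \<cdot> x)"
  proof -
    have "r w = r x + (l x + r t - l x) - r x"
      unfolding w_def p_def using r_K_mult[OF K_closed(1)[OF x t] x] r_K_mult'[OF x t] by simp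
    also have "\<dots> = l x + (r x + r t - r x) - l x"
      using comm by (rule conj_conj_commute)
    finally show ?thesis using r_K_mult[OF t x] by (simp only: group_word)
  qed
  also have "l w = l (x \<cdot> (t \<cdot> x))"
  proof -
    have "l w = r x + (l x + l t - l x) - r x"
      unfolding w_def p_def using l_K_mult'[OF K_closed(1)[OF x t] x] l_K_mult[OF x t] by simp
    also have "\<dots> = l x + (r x + l t - r x) - l x"
      using comm by (rule conj_conj_commute)
    finally show ?thesis using l_K_mult[OF x K(3)] l_K_mult'[OF t x] by simp
  qed
  also have "l (x \<cdot> (t \<cdot> x)) + r (t \<cdot> x) = r (t \<cdot> x) + l x"
    using l_K_mult'[OF x K(3)] by simp
  finally show ?thesis unfolding p_def .
qed

text \<open>Passing from \<open>t\<close> to \<open>f t \<in> K\<close> does not change the classes, so the congruence extends from \<open>K\<close> to \<open>E\<close>;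
as both sides map \<open>t\<close> to \<open>(k \<cdot> t) \<cdot> (t \<cdot> k)\<close>, it is an equation.\<close>

lemma L_R_exchange:
  assumes k: "k \<in> K" and t: "t \<in> E"
  shows "L (k \<cdot> t) + R k = R (t \<cdot> k) + L k"
proof -
  have Q: "k \<in> Q" "t \<in> Q" "f t \<in> K" using k t K_Q E_Q f_E by auto
  have firsts: "R k \<in> firsts" "R t \<in> firsts" "R (f k) \<in> firsts" using k t R_K R_E f_K by auto
  have tk: "R (t \<cdot> k) \<in> firsts"
    using Q firsts by (simp add: R_mult mid.diff_G mid.add_G)
  have "l (k \<cdot> t) = l (k \<cdot> f t)" using Q t by (simp add: l_mult l_E)
  moreover have "r (t \<cdot> k) = r (f t \<cdot> k)" using Q firsts t by (simp add: r_mult R_E R_K)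
  ultimately have "mid.quot (L (k \<cdot> t) + R k) = mid.quot (R (t \<cdot> k) + L k)"
    using l_r_exchange[OF k Q(3)] Q firsts tk by (simp add: mid.quot_add)
  then have "- (R (t \<cdot> k) + L k) + (L (k \<cdot> t) + R k) \<in> middles"
    using Q firsts tk by (subst mid.quot_eq_zero_iff[symmetric])
      (simp_all add: mid.quot_add mid.quot_uminus mid.add_G mid.uminus_G)
  then have "- (R (t \<cdot> k) + L k) + (L (k \<cdot> t) + R k) = 0"
  proof (rule middles_fixpoint)
    show "(- (R (t \<cdot> k) + L k) + (L (k \<cdot> t) + R k)) \<star> t = t"
      using Q by (simp add: uminus_apply_eq_iff)
  qed (use Q in simp)
  then show ?thesis by (metis add.inverse_unique minus_minus)
qed

end

section \<open>A Moufang isotope of an F-quasigroup\<close>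
context quasigroup
begin

text \<open>The principal isotope with identity \<open>a \<cdot> b\<close>.\<close>

definition isotope :: "'a \<Rightarrow> 'a \<Rightarrow> 'a \<Rightarrow> 'a \<Rightarrow> 'a" where
  "isotope a b x y = rdiv x b \<cdot> ldiv a y"

lemma loop_isotope:
  assumes "a \<in> Q" "b \<in> Q" shows "loop Q (isotope a b)"
proof
  fix x y assume xy: "x \<in> Q" "y \<in> Q"
  show "isotope a b x y \<in> Q" unfolding isotope_def using xy assms closed by simp
  show "\<exists>!z. z \<in> Q \<and> isotope a b x z = y"
  proof (rule ex1I[of _ "a \<cdot> ldiv (rdiv x b) y"])
    show "a \<cdot> ldiv (rdiv x b) y \<in> Q \<and> isotope a b x (a \<cdot> ldiv (rdiv x b) y) = y"
      unfolding isotope_def using xy assms closed by simp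
    show "z = a \<cdot> ldiv (rdiv x b) y" if "z \<in> Q \<and> isotope a b x z = y" for z
      using that xy assms closed unfolding isotope_def
      by (metis (no_types, lifting) L_perms R_perms ldiv_eq_iff mult_ldiv perms_apply uminus_perms)
  qed
  show "\<exists>!z. z \<in> Q \<and> isotope a b z x = y"
  proof (rule ex1I[of _ "rdiv y (ldiv a x) \<cdot> b"])
    show "rdiv y (ldiv a x) \<cdot> b \<in> Q \<and> isotope a b (rdiv y (ldiv a x) \<cdot> b) x = y"
      unfolding isotope_def using xy assms closed by simp
    show "z = rdiv y (ldiv a x) \<cdot> b" if "z \<in> Q \<and> isotope a b z x = y" for z
      using that xy assms closed unfolding isotope_def
      by (metis (no_types, lifting) L_perms R_perms rdiv_eq_iff mult_rdiv perms_apply uminus_perms)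
  qed
next
  show "\<exists>u\<in>Q. \<forall>x\<in>Q. isotope a b u x = x \<and> isotope a b x u = x"
    unfolding isotope_def using assms closed
    by (intro bexI[of _ "a \<cdot> b"])
       simp_all
qed

end

text \<open>The group computation behind \<open>quot_Moufang\<close>. The hypotheses force \<open>- a + u + a\<close> and \<open>- o' + u + o'\<close> to be
\<open>u + u\<close>; then both sides of the claim are \<open>u + o'\<close>.\<close>

lemma swap_conjugates:
  fixes a o' u :: "'g::group_add"
  assumes comm: "a + o' = o' + a"
    and conj: "- o' + (a + u - a) + o' = u"
    and prod: "u + a - u = o' + u + a - o'"
  shows "- a + (u + a) + o' - (u + a) + a = - u - o' + u + o' + o'"
proof -
  have conj': "a + u - a = o' + u - o'"
    using arg_cong[OF conj, of "\<lambda>x. o' + x - o'"] by (simp only: group_word)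
  have "- o' + a = a - o'"
    using arg_cong[OF comm, of "\<lambda>x. - o' + x - o'"] by (simp only: group_word)
  then have "o' + u + a - o' = (o' + u - o') + a"
    by (simp only: diff_conv_add_uminus add.assoc)
  then have "u + a - u = (a + u - a) + a" unfolding prod conj' .
  then have "u + a - u = a + u" by simp
  then have ua: "u + a = a + (u + u)" by (metis add.assoc diff_add_cancel)
  have "a + (u + u) - a = o' + (u + u) - o'"
    using arg_cong[OF conj', of "\<lambda>x. x + x"] by (simp only: group_word)
  moreover have "a + (u + u) - a = u" using ua by (metis add_diff_cancel)
  ultimately have "u = o' + (u + u) - o'" by simp
  then have uo: "u + o' = o' + (u + u)" by (metis diff_add_cancel)
  have "- a + (u + a) + o' - (u + a) + a = u + (u + o' - (u + u))"
    unfolding ua by (simp only: group_word)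
  also have "u + o' - (u + u) = o'" unfolding uo by simp
  also have "u + o' = - u - o' + (o' + (u + u)) + o'" by (simp only: group_word)
  also have "\<dots> = - u - o' + u + o' + o'" unfolding uo[symmetric] by (simp only: group_word)
  finally show ?thesis .
qed

context F_quasigroup
begin

context
  fixes k assumes k: "k \<in> K"
begin

abbreviation (input) base :: 'a ("b") where "b \<equiv> k \<cdot> k"

abbreviation lmul :: "'a \<Rightarrow> 'a \<Rightarrow> 'a" (infixl "\<odot>" 70) where
  "x \<odot> y \<equiv> isotope b b x y"

lemma b_K: "b \<in> K" using k by (simp add: K_closed)

lemma b_Q [simp]: "b \<in> Q" "k \<in> Q" using b_K k K_Q by auto

lemma lmul_Q [simp]: "\<lbrakk>x \<in> Q; y \<in> Q\<rbrakk> \<Longrightarrow> x \<odot> y \<in> Q"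
  unfolding isotope_def by simp

lemma L_minus_L_apply: "\<lbrakk>u \<in> Q; y \<in> Q\<rbrakk> \<Longrightarrow> (L u - L b) \<star> y = (u \<cdot> b) \<odot> y"
  unfolding isotope_def by simp

lemma R_minus_R_apply: "\<lbrakk>v \<in> Q; x \<in> Q\<rbrakk> \<Longrightarrow> (R v - R b) \<star> x = x \<odot> (b \<cdot> v)"
  unfolding isotope_def by simp

lemma lmul_one: "x \<in> Q \<Longrightarrow> (b \<cdot> b) \<odot> x = x" "x \<in> Q \<Longrightarrow> x \<odot> (b \<cdot> b) = x"
  unfolding isotope_def
  by simp_all

lemma mult_eq_lmul: "\<lbrakk>x \<in> Q; y \<in> Q\<rbrakk> \<Longrightarrow> x \<cdot> y = (x \<cdot> b) \<odot> (b \<cdot> y)"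
  unfolding isotope_def by simp

lemma lmul_E: "\<lbrakk>x \<in> E; y \<in> E\<rbrakk> \<Longrightarrow> x \<odot> y \<in> E"
  unfolding isotope_def using b_K K_E by (simp add: E_closed)

text \<open>For \<open>t \<in> E\<close> the exchange law says that \<open>L (k \<cdot> t) - L b = R (t \<cdot> k) - R b\<close>, which is the equality of a left
and a right translation of \<open>\<odot>\<close>.\<close>

lemma lmul_commute_E:
  assumes "c \<in> E" "y \<in> Q" shows "c \<odot> y = y \<odot> c"
proof -
  define t where "t = ldiv k (rdiv c b)"
  have t: "t \<in> E" "t \<in> Q" and c: "(k \<cdot> t) \<cdot> b = c" "c \<in> Q"
    using assms k b_K K_E E_Q unfolding t_def by (auto simp: E_closed mult_ldiv mult_rdiv)
  have "L (k \<cdot> t) = R (t \<cdot> k) + L k - R k" "L b = R b + L k - R k"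
    using L_R_exchange[OF k t(1)] L_R_exchange[OF k K_E[OF k]] by (metis add_diff_cancel)+
  then have "L (k \<cdot> t) - L b = R (t \<cdot> k) + L k - R k - (R b + L k - R k)" by simp
  also have "\<dots> = R (t \<cdot> k) - R b" by (simp only: group_word)
  finally have eq: "L (k \<cdot> t) - L b = R (t \<cdot> k) - R b" .
  have *: "c \<odot> z = z \<odot> (b \<cdot> (t \<cdot> k))" if "z \<in> Q" for z
    using L_minus_L_apply[of "k \<cdot> t" z] R_minus_R_apply[of "t \<cdot> k" z] c t that unfolding eq by simp
  have "c = b \<cdot> (t \<cdot> k)" using *[of "b \<cdot> b"] c t by (simp add: lmul_one)
  then show ?thesis using * assms by simp
qed

definition lnuc :: "'a set" where
  "lnuc = {m \<in> Q. \<forall>y\<in>Q. \<forall>z\<in>Q. m \<odot> (y \<odot> z) = (m \<odot> y) \<odot> z}"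

text \<open>The autotopism induced by \<open>L x - L b\<close> has second component \<open>L (e x) - L (e b)\<close>. By \<open>L_F_minus_L_E\<close> this is
a difference of right translations, hence also the second component of an autotopism built from right
translations. The difference of the two autotopisms has trivial second component, so it is a left
translation of \<open>\<odot>\<close> by a left nuclear element. Up to \<open>L (e x) - L (e b)\<close>, which preserves \<open>E\<close>, it agrees
with \<open>L x - L b\<close>, the left translation of \<open>\<odot>\<close> by the arbitrary element \<open>x \<cdot> b\<close>.\<close>

lemma lnuc_E_decomposition:
  assumes q: "q \<in> Q" obtains m c where "m \<in> lnuc" "c \<in> E" "q = m \<odot> c"
proof -
  define x where "x = rdiv q b"
  define w where "w = ldiv (e x) (e b)"
  have x: "x \<in> Q" "x \<cdot> b = q" using q unfolding x_def by (simp_all add: mult_rdiv)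
  have eb: "e b \<in> F" "e b \<in> E" using b_K e_K K_F K_E by auto
  have w: "w \<in> Q" using x unfolding w_def by simp
  have "L (e b) - L (e x) = R w - R (e (e b))"
    unfolding w_def using L_F_minus_L_E[OF eb(1) e_E[OF x(1)]] .
  then have eq: "L (e x) - L (e b) = R (e (e b)) - R w" by (metis minus_diff_eq)
  define \<alpha> where "\<alpha> = (L x - L b) - (R (f (e (e b))) - R (f w))"
  define \<gamma> where "\<gamma> = (L x - L b) - (L (e x) - L (e b))"
  have "autotopism \<alpha> ((L (e x) - L (e b)) - (R (e (e b)) - R w)) ((L x - L b) - (R (e (e b)) - R w))"
    unfolding \<alpha>_def using x w by (intro autotopism_diff autotopism_L autotopism_R) simp_all
  then have aut: "autotopism \<alpha> 0 \<gamma>" unfolding \<gamma>_def eq by simp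
  have perms: "\<alpha> \<in> perms" "\<gamma> \<in> perms" using autotopism_perms[OF aut] by auto
  have \<gamma>_rdiv: "\<alpha> \<star> rdiv y b = rdiv (\<gamma> \<star> y) b" if "y \<in> Q" for y
    using autotopismD[OF aut, of "rdiv y b" b] that perms by (simp add: mult_rdiv rdiv_eq_iff)
  have \<gamma>_lmul: "\<gamma> \<star> (y \<odot> z) = (\<gamma> \<star> y) \<odot> z" if "y \<in> Q" "z \<in> Q" for y z
    using autotopismD[OF aut, of "rdiv y b" "ldiv b z"] that perms
    unfolding isotope_def by (simp add: \<gamma>_rdiv)
  define m where "m = \<gamma> \<star> (b \<cdot> b)"
  have m: "m \<in> Q" "m \<odot> z = \<gamma> \<star> z" if "z \<in> Q" for z
    using \<gamma>_lmul[of "b \<cdot> b" z] that perms unfolding m_def by (simp_all add: lmul_one)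
  define c where "c = (L (e x) - L (e b)) \<star> (b \<cdot> b)"
  have c: "c \<in> E" unfolding c_def using x eb e_E b_K K_E by (simp add: E_closed E_Q)
  have "m \<odot> c = q"
    using m(2)[of c] c E_Q x unfolding \<gamma>_def c_def
    by simp
  moreover have "m \<in> lnuc" unfolding lnuc_def using m(1)[of b] m(2) \<gamma>_lmul perms by simp
  ultimately show ?thesis using that c by metis
qed

text \<open>The given autotopism of \<open>\<odot>\<close> is \<open>(P, S, L u - L b)\<close>. For \<open>x \<in> E\<close> its components may be interchanged because
\<open>x\<close> and \<open>S \<star> x\<close> commute with everything. Left nuclear factors of \<open>x\<close> can be pulled out, since \<open>S\<close> and
\<open>L u - L b\<close> are left translations of \<open>\<odot>\<close> by elements of \<open>E\<close>.\<close>

lemma swapped_autotopism: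
  assumes u: "u \<in> K"
  defines "S \<equiv> L b + (L (e u) - L (e b)) - L b" and "P \<equiv> R b + (L u - L b) - R b"
  assumes xy: "x \<in> Q" "y \<in> Q"
  shows "(L u - L b) \<star> (x \<odot> y) = (S \<star> x) \<odot> (P \<star> y)"
proof -
  define U where "U = L u - L b"
  have uQ: "u \<in> Q" using u K_Q by simp
  have perms: "U \<in> perms" "S \<in> perms" "P \<in> perms" using uQ unfolding U_def S_def P_def by simp_all
  have aut: "autotopism U (L (e u) - L (e b)) U"
    unfolding U_def using uQ by (intro autotopism_diff autotopism_L) simp_all
  have U_lmul: "U \<star> (x' \<odot> y') = (P \<star> x') \<odot> (S \<star> y')" if "x' \<in> Q" "y' \<in> Q" for x' y'
    using autotopismD[OF aut, of "rdiv x' b" "ldiv b y'"] that perms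
    unfolding isotope_def P_def S_def U_def[symmetric] by simp
  define s where "s = (b \<cdot> e u) \<cdot> b"
  define c where "c = u \<cdot> b"
  have s: "s \<in> E" "s \<in> Q" and c: "c \<in> E" "c \<in> Q"
    unfolding s_def c_def using u b_K by (simp_all add: K_E K_closed e_K K_Q)
  have "S = (L b + L (e u)) - (L b + L (e b))" unfolding S_def by (simp only: group_word)
  also have "L b + L (e u) = L (b \<cdot> e u) + L (e b)" using uQ by (intro L_L) simp_all
  also have "L (b \<cdot> e u) + L (e b) - (L b + L (e b)) = L (b \<cdot> e u) - L b" by (simp only: group_word)
  finally have S_eq: "S = L (b \<cdot> e u) - L b" .
  have S_apply: "S \<star> z = s \<odot> z" if "z \<in> Q" for z
    unfolding S_eq s_def using that uQ by (intro L_minus_L_apply) simp_all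
  have U_apply: "U \<star> z = c \<odot> z" if "z \<in> Q" for z
    using that uQ unfolding U_def c_def by (rule L_minus_L_apply[rotated])
  have E_case: "U \<star> (d \<odot> z) = (S \<star> d) \<odot> (P \<star> z)" if d: "d \<in> E" and z: "z \<in> Q" for d z
  proof -
    have "U \<star> (d \<odot> z) = (P \<star> z) \<odot> (S \<star> d)" using U_lmul[OF z E_Q[OF d]] lmul_commute_E[OF d z] by simp
    moreover have "S \<star> d \<in> E" using S_apply[OF E_Q[OF d]] lmul_E[OF s(1) d] by simp
    ultimately show ?thesis using lmul_commute_E perms z by simp
  qed
  have nuc: "c' \<odot> (m \<odot> z) = m \<odot> (c' \<odot> z)" if "c' \<in> E" "m \<in> lnuc" "z \<in> Q" for c' m z
  proof -
    have "m \<in> Q" and m: "\<And>y z. \<lbrakk>y \<in> Q; z \<in> Q\<rbrakk> \<Longrightarrow> m \<odot> (y \<odot> z) = (m \<odot> y) \<odot> z"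
      using that unfolding lnuc_def by auto
    then have "c' \<odot> (m \<odot> z) = m \<odot> (z \<odot> c')"
      using lmul_commute_E[of c' "m \<odot> z"] that E_Q by simp
    then show ?thesis using lmul_commute_E[of c' z] that by simp
  qed
  obtain m d where md: "m \<in> lnuc" "d \<in> E" "x = m \<odot> d" using lnuc_E_decomposition[OF xy(1)] .
  have m: "m \<in> Q" "\<And>y z. \<lbrakk>y \<in> Q; z \<in> Q\<rbrakk> \<Longrightarrow> m \<odot> (y \<odot> z) = (m \<odot> y) \<odot> z"
    using md unfolding lnuc_def by auto
  have d: "d \<in> Q" using md E_Q by simp
  have "U \<star> (x \<odot> y) = c \<odot> (m \<odot> (d \<odot> y))" using U_apply m d xy md by simp
  also have "\<dots> = m \<odot> (U \<star> (d \<odot> y))" using nuc[OF c(1) md(1)] U_apply d xy by simp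
  also have "\<dots> = m \<odot> ((S \<star> d) \<odot> (P \<star> y))" using E_case md xy by simp
  also have "\<dots> = (m \<odot> (S \<star> d)) \<odot> (P \<star> y)" using m d xy perms by simp
  also have "m \<odot> (S \<star> d) = S \<star> x" using nuc[OF s(1) md(1) d] S_apply d m md by simp
  finally show ?thesis unfolding U_def .
qed

text \<open>The interchanged autotopism and the original one have the same third component.\<close>

lemma quot_conj_eq:
  assumes u: "u \<in> K"
  shows "- r b + (l b + (l u - l b) - l b) + r b = l u - l b"
proof -
  define U where "U = L u - L b"
  define S where "S = L b + (L (e u) - L (e b)) - L b"
  define P where "P = R b + U - R b"
  have uQ: "u \<in> Q" using u K_Q by simp
  have perms: "U \<in> perms" "S \<in> perms" "P \<in> perms" using uQ unfolding U_def S_def P_def by simp_all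
  have "autotopism (- R b + S + R b) (- L b + P + L b) U"
    unfolding autotopism_def
  proof (intro conjI ballI)
    fix x y assume xy: "x \<in> Q" "y \<in> Q"
    have "U \<star> (x \<cdot> y) = (S \<star> (x \<cdot> b)) \<odot> (P \<star> (b \<cdot> y))"
      using swapped_autotopism[OF u, of "x \<cdot> b" "b \<cdot> y"] xy mult_eq_lmul[OF xy]
      unfolding U_def S_def P_def by simp
    then show "U \<star> (x \<cdot> y) = ((- R b + S + R b) \<star> x) \<cdot> ((- L b + P + L b) \<star> y)"
      using xy by (simp add: isotope_def)
  qed (use perms in simp_all)
  moreover have "autotopism U (L (e u) - L (e b)) U"
    unfolding U_def using uQ by (intro autotopism_diff autotopism_L) simp_all
  ultimately have "mid.quot (- R b + S + R b) = mid.quot U" by (rule quot_eqI)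
  moreover have "S \<in> firsts" "mid.quot S = l b + (l u - l b) - l b"
    unfolding S_def using uQ u b_K
    by (simp_all add: mid.diff_G mid.add_G mid.quot_add mid.quot_diff l_e)
  ultimately show ?thesis unfolding U_def using uQ R_K[OF b_K]
    by (simp add: mid.quot_add mid.quot_diff mid.quot_uminus mid.add_G mid.uminus_G)
qed

text \<open>The conjugate \<open>- l u + r b + l u\<close> depends on \<open>e u\<close> only, and neither \<open>e u\<close> nor \<open>f v\<close> need be distinguished from
its image in \<open>K\<close>. So the claim for \<open>u\<close> and \<open>v\<close> reduces to that for \<open>e (f u)\<close> and \<open>e (f v)\<close>, where
\<open>quot_conj_eq\<close> applies.\<close>

lemma quot_Moufang:
  assumes u: "u \<in> Q" and v: "v \<in> Q" "u \<cdot> b = b \<cdot> v"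
  shows "- r b + (l u - l b) + r b = l u - l b + r (f v) - r b"
proof -
  define u1 v1 b1 where "u1 = e (f u)" and "v1 = e (f v)" and "b1 = e (f b)"
  have K: "u1 \<in> K" "v1 \<in> K" "b1 \<in> K"
    unfolding u1_def v1_def b1_def using u v by (simp_all add: e_F f_F)
  have b: "b \<in> F" "b \<in> E" using b_K K_F K_E by auto
  have b1: "l b1 = l b" "r b1 = r b" unfolding b1_def
    using l_e[OF f_K[OF b_K]] l_f[OF b(1)] r_e[OF f_F[OF b_Q(1)]] r_f[OF b(1)] by simp_all
  have rv: "r (f v) = - l b + l u1 + r b - l u1 + l b"
  proof -
    have "b1 \<cdot> v1 = u1 \<cdot> b1" unfolding u1_def v1_def b1_def
      using v u by (simp add: f_mult[symmetric] e_mult[symmetric])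
    then have "l b + r v1 - l b = l u1 + r b - l u1"
      using r_K_mult'[OF K(3,2)] r_K_mult'[OF K(1,3)] b1 by simp
    then have "- l b + (l b + r v1 - l b) + l b = - l b + (l u1 + r b - l u1) + l b" by simp
    then have "r v1 = - l b + l u1 + r b - l u1 + l b" by (simp only: group_word)
    moreover have "r v1 = r (f v)" unfolding v1_def using v by (simp add: r_e f_F)
    ultimately show ?thesis by simp
  qed
  have conj: "- l u + r b + l u = - l u1 + r b + l u1"
  proof -
    have "- l u + r b + l u = r (ldiv (e u) b)"
      using u R_K[OF b_K] by (simp add: R_ldiv_e mid.quot_add mid.quot_uminus mid.add_G mid.uminus_G)
    also have "\<dots> = r (f (ldiv (e u) b))" using R_E(2) E_closed(2)[OF e_E[OF u] b(2)] by simp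
    also have "f (ldiv (e u) b) = ldiv u1 (f b)" unfolding u1_def using u by (simp add: f_ldiv e_f)
    also have "r (ldiv u1 (f b)) = - l u1 + r b + l u1"
    proof -
      define w where "w = ldiv u1 (f b)"
      have w: "w \<in> K" "u1 \<cdot> w = f b"
        unfolding w_def using K f_K[OF b_K] K_closed K_Q by (auto simp: mult_ldiv)
      have "r b = l u1 + r w - l u1"
        using r_K_mult'[OF K(1) w(1)] w r_f[OF b(1)] by simp
      then show ?thesis unfolding w_def[symmetric] by (simp only: group_word)
    qed
    finally show ?thesis .
  qed
  define a o' u' where "a = l b" and "o' = r b" and "u' = l u1 - l b"
  have comm: "a + o' = o' + a" unfolding a_def o'_def using b_K by (rule l_r_commute)
  have lu1: "l u1 = u' + a" unfolding u'_def a_def by simp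
  have swap: "- a + (u' + a) + o' - (u' + a) + a = - u' - o' + u' + o' + o'"
  proof (rule swap_conjugates[OF comm])
    show "- o' + (a + u' - a) + o' = u'"
      using quot_conj_eq[OF K(1)] unfolding a_def o'_def u'_def .
    have "l u1 + a - l u1 = o' + l u1 - o'"
      unfolding a_def o'_def using l_K_mult[OF K(1) b_K] l_K_mult'[OF K(1) b_K] by simp
    then show "u' + a - u' = o' + u' + a - o'" unfolding lu1 by (simp only: group_word)
  qed
  define U where "U = l u - l b"
  have "- U + o' + U = a + (- l u + o' + l u) - a" unfolding U_def a_def by (simp only: group_word)
  also have "\<dots> = - u' + o' + u'" using conj unfolding u'_def a_def o'_def by (simp only: group_word)
  finally have conj': "- U + o' + U = - u' + o' + u'" .
  have "r (f v) = - u' - o' + u' + o' + o'" using rv swap lu1 unfolding a_def o'_def by simp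
  also have "\<dots> = - (- u' + o' + u') + o' + o'" by (simp only: group_word)
  also have "\<dots> = - U - o' + U + o' + o'" unfolding conj'[symmetric] by (simp only: group_word)
  finally have "U + r (f v) - o' = - o' + U + o'" by (simp only: group_word)
  then show ?thesis unfolding U_def o'_def by simp
qed

lemma Moufang_loop_lmul: "Moufang_loop Q (\<odot>)"
proof -
  interpret lp: loop Q "(\<odot>)" by (rule loop_isotope) simp_all
  show ?thesis
  proof
    fix c x y assume c: "c \<in> Q" and x: "x \<in> Q" and y: "y \<in> Q"
    define u v where "u = rdiv c b" and "v = ldiv b c"
    have u: "u \<in> Q" "u \<cdot> b = c" and v: "v \<in> Q" "b \<cdot> v = c"
      unfolding u_def v_def using c by (simp_all add: mult_ldiv mult_rdiv)
    define C where "C = L u - L b + (R v - R b)"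
    define A where "A = - R b + (L u - L b) + R b"
    have b: "R b \<in> firsts" "R (f b) \<in> firsts" "r (f b) = r b" "R (f v) \<in> firsts"
      using b_K R_K f_K r_f K_F R_F_firsts f_F v by auto
    have A: "A \<in> firsts" "mid.quot A = - r b + (l u - l b) + r b"
      unfolding A_def using u b
      by (simp_all add: mid.add_G mid.diff_G mid.uminus_G mid.quot_add mid.quot_diff mid.quot_uminus)
    have "autotopism (L u - L b + (R (f v) - R (f b))) (L (e u) - L (e b) + (R v - R b)) C"
      unfolding C_def using u v by (intro autotopism_add autotopism_diff autotopism_L autotopism_R) simp_all
    moreover have "mid.quot (L u - L b + (R (f v) - R (f b))) = mid.quot A"
      using quot_Moufang[OF u(1) v(1)] u v A b
      by (simp add: mid.quot_add mid.quot_diff mid.diff_G mid.add_G add_diff_eq)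
    ultimately obtain B where B: "autotopism A B C" using autotopism_quot_eq A(1) by metis
    have C_apply: "C \<star> z = c \<odot> (z \<odot> c)" if "z \<in> Q" for z
      using that u v L_minus_L_apply[OF u(1), of "z \<odot> c"] R_minus_R_apply[OF v(1) that] c
      unfolding C_def by simp
    have key: "c \<odot> ((x' \<odot> y) \<odot> c) = (c \<odot> x') \<odot> (b \<cdot> (B \<star> ldiv b y))" if x': "x' \<in> Q" for x'
    proof -
      have "C \<star> (x' \<odot> y) = (A \<star> rdiv x' b) \<cdot> (B \<star> ldiv b y)"
        unfolding isotope_def using autotopismD[OF B] x' y by simp
      also have "A \<star> rdiv x' b = rdiv (c \<odot> x') b"
        unfolding A_def using x' u L_minus_L_apply[OF u(1) x'] by simp
      finally show ?thesis
        using C_apply[of "x' \<odot> y"] x' y autotopism_perms(2)[OF B]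
        by (simp add: isotope_def[of _ _ "c \<odot> x'"] ldiv_eq_iff[THEN iffD2])
    qed
    have "c \<odot> (y \<odot> c) = c \<odot> (b \<cdot> (B \<star> ldiv b y))"
      using key[of "b \<cdot> b"] c y by (simp add: lmul_one)
    then have "y \<odot> c = b \<cdot> (B \<star> ldiv b y)"
      using lp.left_cancel[of c] c y autotopism_perms(2)[OF B] by simp
    then show "c \<odot> ((x \<odot> y) \<odot> c) = (c \<odot> x) \<odot> (y \<odot> c)" using key[OF x] by simp
  qed
qed

end

end

section \<open>Isotopes of Moufang loops\<close>
lemma Moufang_loop_isomorphic:
  assumes M: "Moufang_loop P n" and "loop Q m" and \<gamma>: "bij_betw \<gamma> Q P"
    and hom: "\<And>x y. \<lbrakk>x \<in> Q; y \<in> Q\<rbrakk> \<Longrightarrow> \<gamma> (m x y) = n (\<gamma> x) (\<gamma> y)"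
  shows "Moufang_loop Q m"
proof -
  interpret M: Moufang_loop P n by fact
  interpret loop Q m by fact
  show ?thesis
  proof
    fix x y z assume xyz: "x \<in> Q" "y \<in> Q" "z \<in> Q"
    then have "\<gamma> x \<in> P" "\<gamma> y \<in> P" "\<gamma> z \<in> P" using \<gamma> bij_betwE by auto
    then have "\<gamma> (m x (m (m y z) x)) = \<gamma> (m (m x y) (m z x))"
      using xyz by (simp add: hom closed M.Moufang)
    then show "m x (m (m y z) x) = m (m x y) (m z x)"
      using \<gamma> xyz closed by (metis (no_types, lifting) bij_betw_def inj_onD)
  qed
qed

context loop
begin

lemma L_one: "L \<one> = 0" and R_one: "R \<one> = 0"
  by (rule perms_eqI; simp add: one)+

end

context Moufang_loop
begin

lemma flexible: "\<lbrakk>x \<in> Q; y \<in> Q\<rbrakk> \<Longrightarrow> x \<cdot> (y \<cdot> x) = (x \<cdot> y) \<cdot> x"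
  using Moufang[of x y \<one>] by (simp add: one closed)

lemma Moufang_loop_opposite: "Moufang_loop Q (\<lambda>x y. y \<cdot> x)"
proof
  show "\<exists>u\<in>Q. \<forall>x\<in>Q. x \<cdot> u = x \<and> u \<cdot> x = x" using ex_identity by blast
  show "(x \<cdot> (z \<cdot> y)) \<cdot> x = (x \<cdot> z) \<cdot> (y \<cdot> x)" if "x \<in> Q" "y \<in> Q" "z \<in> Q" for x y z
    using that by (simp add: flexible[symmetric] closed Moufang)
qed (simp_all add: closed ex1_left ex1_right)

definition inverse :: "'a \<Rightarrow> 'a" where "inverse x = ldiv x \<one>"

lemma inverse_Q [simp]: "x \<in> Q \<Longrightarrow> inverse x \<in> Q"
  unfolding inverse_def by (simp add: one)

lemma mult_inverse: "x \<in> Q \<Longrightarrow> x \<cdot> inverse x = \<one>"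
  unfolding inverse_def by (simp add: one)

text \<open>The left inverse property: in the Moufang identity the factor \<open>x \<cdot> inverse x\<close> vanishes.\<close>

lemma ldiv_eq_inverse_mult: assumes "x \<in> Q" "z \<in> Q" shows "ldiv x z = inverse x \<cdot> z"
proof -
  have "(x \<cdot> (inverse x \<cdot> z)) \<cdot> x = z \<cdot> x"
    using Moufang[of x "inverse x" z] assms by (simp add: flexible closed mult_inverse one)
  then show ?thesis using assms by (simp add: right_cancel closed ldiv_eq_iff)
qed

lemma rdiv_one: assumes x: "x \<in> Q" shows "rdiv \<one> x = inverse x"
proof -
  define y where "y = rdiv \<one> x"
  have y: "y \<in> Q" "y \<cdot> x = \<one>" unfolding y_def using x by (simp_all add: one)
  then have "inverse y = x" unfolding inverse_def using x by (simp add: ldiv_eq_iff one)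
  then have "x \<cdot> y = ldiv y y" using ldiv_eq_inverse_mult[of y y] y by simp
  also have "\<dots> = x \<cdot> inverse x" using x y by (simp add: ldiv_eq_iff one mult_inverse)
  finally show ?thesis unfolding y_def[symmetric] using x y by (simp add: left_cancel)
qed

lemma inverse_mult: "x \<in> Q \<Longrightarrow> inverse x \<cdot> x = \<one>"
  by (simp add: rdiv_one[symmetric] one)

lemma inverse_inverse: "x \<in> Q \<Longrightarrow> inverse (inverse x) = x"
  unfolding inverse_def[of "inverse x"] by (simp add: ldiv_eq_iff one inverse_mult)

lemma rdiv_eq_mult_inverse: assumes "x \<in> Q" "y \<in> Q" shows "rdiv y x = y \<cdot> inverse x"
proof -
  have "x \<cdot> ((y \<cdot> inverse x) \<cdot> x) = x \<cdot> y"
    using Moufang[of x y "inverse x"] assms by (simp add: inverse_mult one closed)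
  then show ?thesis using assms by (simp add: left_cancel closed rdiv_eq_iff)
qed

lemma inverse_product:
  assumes "x \<in> Q" "z \<in> Q" shows "inverse (z \<cdot> x) = inverse x \<cdot> inverse z"
proof -
  have "rdiv x (z \<cdot> x) = inverse z"
    using assms by (simp add: rdiv_eq_iff ldiv_eq_inverse_mult[symmetric] closed)
  then have "x \<cdot> inverse (z \<cdot> x) = inverse z"
    using assms by (simp add: rdiv_eq_mult_inverse closed)
  then show ?thesis using assms by (metis closed inverse_Q ldiv_eq_inverse_mult ldiv_mult)
qed

lemma autotopism_Moufang: "x \<in> Q \<Longrightarrow> autotopism (L x) (R x) (L x + R x)"
  unfolding autotopism_def by (simp add: closed Moufang)

text \<open>The Moufang identity after division by \<open>inverse v \<cdot> x\<close>.\<close>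

lemma autotopism_Bol:
  assumes x: "x \<in> Q" shows "autotopism (L x + R x) (- L x) (L x)"
  unfolding autotopism_def
proof (intro conjI ballI)
  fix q v assume q: "q \<in> Q" and v: "v \<in> Q"
  have "x \<cdot> (((q \<cdot> v) \<cdot> inverse v) \<cdot> x) = (x \<cdot> (q \<cdot> v)) \<cdot> (inverse v \<cdot> x)"
    using x q v by (intro Moufang) (simp_all add: closed)
  moreover have "(q \<cdot> v) \<cdot> inverse v = q" using q v by (simp add: rdiv_eq_mult_inverse[symmetric] closed)
  ultimately have "x \<cdot> (q \<cdot> v) = (x \<cdot> (q \<cdot> x)) \<cdot> inverse (inverse v \<cdot> x)"
    using x q v by (simp add: rdiv_eq_mult_inverse[symmetric] closed)
  then show "L x \<star> (q \<cdot> v) = ((L x + R x) \<star> q) \<cdot> ((- L x) \<star> v)"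
    using x q v by (simp add: inverse_product inverse_inverse ldiv_eq_inverse_mult closed)
qed (use x in simp_all)

text \<open>Conjugating the Moufang autotopism of \<open>v = a \<setminus> c\<close> by the Bol autotopism of \<open>a\<close> gives an autotopism whose
first two components correspond to the translations by \<open>c\<close> in the isotope; evaluation at the identity \<open>a\<close> of the
isotope shows that its third component is the one the Moufang identity requires.\<close>

lemma Moufang_loop_left_isotope:
  assumes a: "a \<in> Q" shows "Moufang_loop Q (isotope a \<one>)"
proof -
  interpret iso: loop Q "isotope a \<one>" using a by (intro loop_isotope one)
  have iso_apply: "isotope a \<one> x y = x \<cdot> ldiv a y" for x y
    unfolding isotope_def by (simp add: R_one)
  show ?thesis
  proof
    fix c x y assume c: "c \<in> Q" and x: "x \<in> Q" and y: "y \<in> Q"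
    define v where "v = ldiv a c"
    have v: "v \<in> Q" "a \<cdot> v = c" unfolding v_def using a c by simp_all
    define T where "T = L a + R a"
    define C where "C = L a + (L v + R v) - L a"
    have "autotopism (T + L v - T) (- L a + R v - - L a) C"
      unfolding C_def T_def using a v
      by (intro autotopism_diff autotopism_add[of "L a + R a" _ _ "L v"] autotopism_Bol autotopism_Moufang)
    moreover have "T + L v = L c + R a"
      unfolding T_def using autotopismD[OF autotopism_Moufang[OF a] v(1)] a v c
      by (intro perms_eqI) (simp_all add: closed)
    then have "T + L v - T = L c - L a" unfolding T_def by (simp only: group_word)
    ultimately have aut: "autotopism (L c - L a) (- L a + R v - - L a) C" by simp
    have C_iso: "C \<star> isotope a \<one> x' y = isotope a \<one> (isotope a \<one> c x') (isotope a \<one> y c)"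
      if "x' \<in> Q" for x'
      using autotopismD[OF aut that, of "ldiv a y"] a c y that unfolding iso_apply v_def by simp
    have "ldiv a a = \<one>" using a by (simp add: ldiv_eq_iff one)
    then have "C \<star> z = isotope a \<one> c (isotope a \<one> z c)" if "z \<in> Q" for z
      using autotopismD[OF aut a, of "ldiv a z"] a c v that unfolding iso_apply v_def by (simp add: one)
    then show "isotope a \<one> c (isotope a \<one> (isotope a \<one> x y) c)
        = isotope a \<one> (isotope a \<one> c x) (isotope a \<one> y c)"
      using C_iso[OF x] iso.closed[OF x y] by simp
  qed
qed

lemma Moufang_loop_right_isotope:
  assumes b: "b \<in> Q" shows "Moufang_loop Q (isotope \<one> b)"
proof -
  interpret op: Moufang_loop Q "\<lambda>x y. y \<cdot> x" by (rule Moufang_loop_opposite)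
  interpret op_iso: Moufang_loop Q "op.isotope b op.one" using b by (rule op.Moufang_loop_left_isotope)
  show ?thesis
  proof (rule Moufang_loop_isomorphic[OF op_iso.Moufang_loop_opposite, of _ _ id])
    show "loop Q (isotope \<one> b)" using b by (intro loop_isotope one)
    have "op.L b = R b" unfolding op.L_def R_def ..
    then show "id (isotope \<one> b x y) = op.isotope b op.one (id y) (id x)" for x y
      unfolding op.isotope_def isotope_def by (simp add: op.R_one L_one)
  qed simp
qed

text \<open>An arbitrary principal isotope arises in two steps, one for each factor. The second step is taken in the
isotope obtained first, where the element \<open>a \<cdot> b\<close> plays the part of \<open>b\<close>.\<close>

lemma Moufang_loop_isotope:
  assumes a: "a \<in> Q" and b: "b \<in> Q" shows "Moufang_loop Q (isotope a b)"
proof -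
  interpret left: Moufang_loop Q "isotope a \<one>" using a by (rule Moufang_loop_left_isotope)
  show ?thesis
  proof (rule Moufang_loop_isomorphic[OF left.Moufang_loop_right_isotope, of "a \<cdot> b" _ _ id])
    show "loop Q (isotope a b)" using a b by (rule loop_isotope)
    fix x y assume "x \<in> Q" "y \<in> Q"
    moreover have "left.rdiv x (a \<cdot> b) = rdiv x b" if "x \<in> Q" for x
      using that a b by (simp add: left.rdiv_eq_iff closed isotope_def R_one)
    ultimately show "id (isotope a b x y) = left.isotope left.one (a \<cdot> b) (id x) (id y)"
      unfolding left.isotope_def by (simp add: left.L_one isotope_def R_one)
  qed (simp_all add: a b closed)
qed

end

section \<open>M-loops isotopic to F-quasigroups\<close>

theorem corollary4p5:
  fixes Q :: "'a set" and ast :: "'a \<Rightarrow> 'a \<Rightarrow> 'a"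
    and P :: "'b set" and dot :: "'b \<Rightarrow> 'b \<Rightarrow> 'b"
  assumes "M_loop Q ast"
    and "F_quasigroup P dot"
    and "isotopic Q ast P dot"
  shows "Moufang_loop Q ast"
proof -
  interpret Q: M_loop Q ast by fact
  interpret P: F_quasigroup P dot by fact
  obtain \<alpha> \<beta> \<gamma> where bij: "bij_betw \<alpha> Q P" "bij_betw \<beta> Q P" "bij_betw \<gamma> Q P"
    and iso: "\<And>x y. \<lbrakk>x \<in> Q; y \<in> Q\<rbrakk> \<Longrightarrow> \<gamma> (ast x y) = dot (\<alpha> x) (\<beta> y)"
    using assms(3) unfolding isotopic_def by blast
  have mem: "\<alpha> x \<in> P" "\<beta> x \<in> P" "\<gamma> x \<in> P" if "x \<in> Q" for x
    using that bij bij_betwE by blast+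
  \<comment> \<open>Any element of \<open>K\<close> will do as base point.\<close>
  define k where "k = P.e (P.f (\<gamma> Q.one))"
  have k: "k \<in> P.K" unfolding k_def using mem(3)[OF Q.one(1)] by (simp add: P.e_F P.f_F)
  define b where "b = dot k k"
  have b: "b \<in> P" using k P.K_Q unfolding b_def by simp
  interpret M: Moufang_loop P "P.isotope b b" unfolding b_def using k by (rule P.Moufang_loop_lmul)
  have split: "\<gamma> (ast x y) = P.isotope b b (dot (\<alpha> x) b) (dot b (\<beta> y))" if "x \<in> Q" "y \<in> Q" for x y
    using iso[OF that] mem that b unfolding P.isotope_def by simp
  \<comment> \<open>Putting the identity for one factor exhibits \<open>\<gamma>\<close> as an isomorphism onto a principal isotope.\<close>
  define u v where "u = dot (\<alpha> Q.one) b" and "v = dot b (\<beta> Q.one)"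
  have uv: "u \<in> P" "v \<in> P" unfolding u_def v_def using mem Q.one(1) b by simp_all
  show ?thesis
  proof (rule Moufang_loop_isomorphic[OF M.Moufang_loop_isotope[OF uv] Q.loop_axioms bij(3)])
    fix x y assume xy: "x \<in> Q" "y \<in> Q"
    have "\<gamma> x = P.isotope b b (dot (\<alpha> x) b) v" "\<gamma> y = P.isotope b b u (dot b (\<beta> y))"
      unfolding u_def v_def using split[OF xy(1) Q.one(1)] split[OF Q.one(1) xy(2)] xy
      by (simp_all add: Q.one)
    then show "\<gamma> (ast x y) = M.isotope u v (\<gamma> x) (\<gamma> y)"
      unfolding M.isotope_def split[OF xy] using uv mem xy b by simp
  qed
qed

end
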